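(* Let $p\in[1,\infty]$, let $q$ be its dual number ($1/p+1/q=1$, with $1/\infty=0$), and let $\Gamma$ be a discrete group. Assume that $\Gamma$ has property $(RD)_q$. If $C^{\ast}_r(\Gamma)$ has no nontrivial idempotents, then both $B^p_r(\Gamma)$ and $B^q_r(\Gamma)$ have no nontrivial idempotents.
   Context: An idempotent in a unital Banach algebra $A$ is an element $a\in A$ with $a^2=a$; it is nontrivial if it is neither $0$ nor the unit element $I$. For a discrete group $\Gamma$, $\mathbb{C}\Gamma$ is the group algebra of finitely supported functions $f=\sum_{\alpha\in\Gamma}f_\alpha\alpha$ on $\Gamma$ with the convolution product. For $r\in[1,\infty]$, the left regular representation $\lambda:\Gamma\to\mathcal{B}(\ell^r(\Gamma))$ is $(\lambda(\gamma)\xi)(\alpha)=\xi(\gamma^{-1}\alpha)$, and for $f\in\mathbb{C}\Gamma$ one sets $\|f\|_{\mathcal{B}(\ell^r(\Gamma))}:=\|\sum_{\alpha}f_\alpha\lambda(\alpha)\|$ (operator norm on $\ell^r(\Gamma)$). The reduced group $\ell^r$-operator algebra $B^r_r(\Gamma)$ with exponent $r$ (written $B^p_r(\Gamma)$ for exponent $p$ and $B^q_r(\Gamma)$ for exponent $q$; the subscript $r$ stands for "reduced") is the closure of $\mathbb{C}\Gamma$ (acting through $\lambda$) in this norm. $C^{\ast}_r(\Gamma)=B^2_r(\Gamma)$ is the reduced group $C^{\ast}$-algebra. A length function on $\Gamma$ is a function $l:\Gamma\to[0,\infty)$ such that $l(\gamma)=0$ iff $\gamma$ is the identity element $e$, $l(\gamma^{-1})=l(\gamma)$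 for all $\gamma$, and $l(\gamma_1\gamma_2)\le l(\gamma_1)+l(\gamma_2)$ for all $\gamma_1,\gamma_2$. For $n\ge 0$ let $B_n(e)=\{\gamma\in\Gamma: l(\gamma)\le n\}$. For $q\in[1,\infty]$, $\Gamma$ has property $(RD)_q$ with respect to $l$ if there is a polynomial $\mathcal{P}$ such that for every $n\ge 0$ and every $f\in\mathbb{C}\Gamma$ with support in $B_n(e)$, $\|f\|_{\mathcal{B}(\ell^q(\Gamma))}\le\mathcal{P}(n)\|f\|_{\ell^q(\Gamma)}$. $\Gamma$ has property $(RD)_q$ if it has it with respect to some length function. *)

theory Defs
  imports
    "HOL-Analysis.Analysis"
    "HOL-Computational_Algebra.Polynomial"
    "HOL-Algebra.Ring"
begin

text \<open>Exponents are of type \<^typ>\<open>ennreal\<close>, where \<open>1 / \<infinity> = 0\<close>; only values at least \<open>1\<close> are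
  meaningful. Elements of \<open>\<ell>\<^sup>r(I)\<close> are represented by functions on the whole type that vanish
  outside the index set \<open>I\<close>.\<close>

definition ell :: "ennreal \<Rightarrow> 'a set \<Rightarrow> ('a \<Rightarrow> complex) set" where
  "ell r I = {\<xi>. (\<forall>x. x \<notin> I \<longrightarrow> \<xi> x = 0) \<and>
     (if r = \<infinity> then bounded (\<xi> ` I)
      else (\<lambda>x. cmod (\<xi> x) powr enn2real r) summable_on I)}"

definition ell_norm :: "ennreal \<Rightarrow> 'a set \<Rightarrow> ('a \<Rightarrow> complex) \<Rightarrow> real" where
  "ell_norm r I \<xi> =
     (if r = \<infinity> then (SUP x\<in>I. cmod (\<xi> x))
      else (\<Sum>\<^sub>\<infinity>x\<in>I. cmod (\<xi> x) powr enn2real r) powr (1 / enn2real r))"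

text \<open>Operators are extensional functions (\<^term>\<open>undefined\<close> outside \<^term>\<open>ell r I\<close>), so that equality
  of operators is equality in HOL.\<close>

definition ell_operators ::
  "ennreal \<Rightarrow> 'a set \<Rightarrow> (('a \<Rightarrow> complex) \<Rightarrow> ('a \<Rightarrow> complex)) set" where
  "ell_operators r I = {T \<in> ell r I \<rightarrow>\<^sub>E ell r I.
     (\<forall>\<xi>\<in>ell r I. \<forall>\<eta>\<in>ell r I. T (\<lambda>x. \<xi> x + \<eta> x) = (\<lambda>x. T \<xi> x + T \<eta> x)) \<and>
     (\<forall>c. \<forall>\<xi>\<in>ell r I. T (\<lambda>x. c * \<xi> x) = (\<lambda>x. c * T \<xi> x)) \<and>
     (\<exists>K. \<forall>\<xi>\<in>ell r I. ell_norm r I (T \<xi>) \<le> K * ell_norm r I \<xi>)}"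

text \<open>The operator norm; a junk value may result if \<open>T\<close> is not bounded.\<close>

definition op_norm ::
  "ennreal \<Rightarrow> 'a set \<Rightarrow> (('a \<Rightarrow> complex) \<Rightarrow> ('a \<Rightarrow> complex)) \<Rightarrow> real" where
  "op_norm r I T = Sup {ell_norm r I (T \<xi>) | \<xi>. \<xi> \<in> ell r I \<and> ell_norm r I \<xi> \<le> 1}"

definition group_algebra :: "('a, 'm) monoid_scheme \<Rightarrow> ('a \<Rightarrow> complex) set" where
  "group_algebra G = {f. finite {\<gamma>. f \<gamma> \<noteq> 0} \<and> {\<gamma>. f \<gamma> \<noteq> 0} \<subseteq> carrier G}"

definition left_regular ::
  "('a, 'm) monoid_scheme \<Rightarrow> ennreal \<Rightarrow> 'a \<Rightarrow> ('a \<Rightarrow> complex) \<Rightarrow> ('a \<Rightarrow> complex)" where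
  "left_regular G r \<gamma> = (\<lambda>\<xi>\<in>ell r (carrier G).
     \<lambda>\<alpha>. if \<alpha> \<in> carrier G then \<xi> (inv\<^bsub>G\<^esub> \<gamma> \<otimes>\<^bsub>G\<^esub> \<alpha>) else 0)"

definition left_regular_alg ::
  "('a, 'm) monoid_scheme \<Rightarrow> ennreal \<Rightarrow> ('a \<Rightarrow> complex) \<Rightarrow> ('a \<Rightarrow> complex) \<Rightarrow> ('a \<Rightarrow> complex)" where
  "left_regular_alg G r f = (\<lambda>\<xi>\<in>ell r (carrier G).
     \<lambda>\<alpha>. \<Sum>\<gamma>\<in>{\<gamma>. f \<gamma> \<noteq> 0}. f \<gamma> * left_regular G r \<gamma> \<xi> \<alpha>)"

text \<open>The algebra \<open>B\<^sup>r\<^sub>r(\<Gamma>)\<close>, as a unital ring of operators on \<open>\<ell>\<^sup>r(\<Gamma>)\<close>: its carrier is the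
  operator norm closure of the image of the group algebra.\<close>

definition reduced_algebra ::
  "('a, 'm) monoid_scheme \<Rightarrow> ennreal \<Rightarrow> (('a \<Rightarrow> complex) \<Rightarrow> ('a \<Rightarrow> complex)) ring" where
  "reduced_algebra G r = (let E = ell r (carrier G) in
     \<lparr> carrier = {T \<in> ell_operators r (carrier G).
         \<forall>\<epsilon>>0. \<exists>f\<in>group_algebra G.
           op_norm r (carrier G) (\<lambda>\<xi>\<in>E. \<lambda>\<alpha>. T \<xi> \<alpha> - left_regular_alg G r f \<xi> \<alpha>) < \<epsilon>},
       mult = compose E,
       one = (\<lambda>\<xi>\<in>E. \<xi>),
       zero = (\<lambda>\<xi>\<in>E. \<lambda>\<alpha>. 0),
       add = (\<lambda>S T. \<lambda>\<xi>\<in>E. \<lambda>\<alpha>. S \<xi> \<alpha> + T \<xi> \<alpha>) \<rparr>)"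

definition reduced_cstar_algebra ::
  "('a, 'm) monoid_scheme \<Rightarrow> (('a \<Rightarrow> complex) \<Rightarrow> ('a \<Rightarrow> complex)) ring" where
  "reduced_cstar_algebra G = reduced_algebra G 2"

definition idempotent :: "('b, 'm) ring_scheme \<Rightarrow> 'b \<Rightarrow> bool" where
  "idempotent R a \<longleftrightarrow> a \<in> carrier R \<and> a \<otimes>\<^bsub>R\<^esub> a = a"

definition nontrivial_idempotent :: "('b, 'm) ring_scheme \<Rightarrow> 'b \<Rightarrow> bool" where
  "nontrivial_idempotent R a \<longleftrightarrow> idempotent R a \<and> a \<noteq> \<zero>\<^bsub>R\<^esub> \<and> a \<noteq> \<one>\<^bsub>R\<^esub>"

definition length_function :: "('a, 'm) monoid_scheme \<Rightarrow> ('a \<Rightarrow> real) \<Rightarrow> bool" where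
  "length_function G l \<longleftrightarrow>
     (\<forall>\<gamma>\<in>carrier G. 0 \<le> l \<gamma>) \<and>
     (\<forall>\<gamma>\<in>carrier G. l \<gamma> = 0 \<longleftrightarrow> \<gamma> = \<one>\<^bsub>G\<^esub>) \<and>
     (\<forall>\<gamma>\<in>carrier G. l (inv\<^bsub>G\<^esub> \<gamma>) = l \<gamma>) \<and>
     (\<forall>\<gamma>\<^sub>1\<in>carrier G. \<forall>\<gamma>\<^sub>2\<in>carrier G. l (\<gamma>\<^sub>1 \<otimes>\<^bsub>G\<^esub> \<gamma>\<^sub>2) \<le> l \<gamma>\<^sub>1 + l \<gamma>\<^sub>2)"

definition length_ball :: "('a, 'm) monoid_scheme \<Rightarrow> ('a \<Rightarrow> real) \<Rightarrow> nat \<Rightarrow> 'a set" where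
  "length_ball G l n = {\<gamma> \<in> carrier G. l \<gamma> \<le> real n}"

definition RD_wrt :: "('a, 'm) monoid_scheme \<Rightarrow> ennreal \<Rightarrow> ('a \<Rightarrow> real) \<Rightarrow> bool" where
  "RD_wrt G q l \<longleftrightarrow> (\<exists>P :: real poly. \<forall>n. \<forall>f\<in>group_algebra G.
     {\<gamma>. f \<gamma> \<noteq> 0} \<subseteq> length_ball G l n \<longrightarrow>
     op_norm q (carrier G) (left_regular_alg G q f) \<le> poly P (real n) * ell_norm q (carrier G) f)"

definition property_RD :: "('a, 'm) monoid_scheme \<Rightarrow> ennreal \<Rightarrow> bool" where
  "property_RD G q \<longleftrightarrow> (\<exists>l. length_function G l \<and> RD_wrt G q l)"

end

theory Submission
  imports Defs
begin

text \<open>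
  Write \<open>N\<^sub>r(f)\<close> for the norm of a finitely supported \<open>f\<close> acting by left convolution on \<open>\<ell>\<^sup>r(\<Gamma>)\<close>
  (\<open>alg_norm\<close> below). Let \<open>a\<close> be an idempotent of \<open>B\<^sup>r\<^sub>r(\<Gamma>)\<close> with \<open>r = p\<close> or \<open>r = q\<close>. The idea is to
  replace \<open>a\<close> by a nearby idempotent that also lives in \<open>C\<^sup>*\<^sub>r(\<Gamma>)\<close>, where it must be \<open>0\<close> or \<open>1\<close>.
  The bridge between the two algebras is the group algebra, whose elements carry both norms.

  \<^bold>\<open>Comparison of norms.\<close> If \<open>f\<close> has support in the ball of radius \<open>n\<close> and \<open>P\<close> is the polynomial
  of the property \<open>(RD)\<^sub>q\<close>, then \<open>N\<^sub>2(f) \<le> \<bar>P(n)\<bar> \<parallel>f\<parallel>\<^sub>q \<le> \<bar>P(n)\<bar> N\<^sub>r(f)\<close>. For the first inequality,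
  \<open>N\<^sub>2(f)\<^sup>2 = N\<^sub>2(f\<^sup>* f) \<le> N\<^sub>q(f\<^sup>* f) \<le> N\<^sub>q(f\<^sup>*) N\<^sub>q(f)\<close>, where the middle step is a spectral radius
  argument for symmetric operators (\<open>symmetric_operator_bound\<close>), and both factors are controlled by
  \<open>(RD)\<^sub>q\<close> because \<open>f\<^sup>*\<close> has the same length and the same \<open>\<ell>\<^sup>q\<close> norm as \<open>f\<close> (\<open>RD_alg_norm_2_le\<close>). For
  the second, apply \<open>f\<close> to the unit mass if \<open>r = q\<close>, and to the extremal vector of Hoelder's
  inequality if \<open>r = p\<close> (\<open>ell_norm_le_conjugate_alg_norm\<close>).

  \<^bold>\<open>Newton's method.\<close> Choose \<open>f\<close> in the group algebra so close to \<open>a\<close> that \<open>f\<^sup>2 - f\<close> is small in \<open>N\<^sub>r\<close>,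
  and iterate \<open>e \<mapsto> 3e\<^sup>2 - 2e\<^sup>3\<close> from \<open>f\<close>. With \<open>h = e\<^sup>2 - e\<close>, one step replaces \<open>h\<close> by \<open>4h\<^sup>3 - 3h\<^sup>2\<close>,
  so \<open>N\<^sub>r(h)\<close> decays doubly exponentially (\<open>newton_decay\<close>), whereas the radius of the support only
  triples. The polynomial loss in the comparison of norms therefore costs only a geometric factor:
  the iterates form a Cauchy sequence also for \<open>N\<^sub>2\<close>, and they converge to an idempotent of
  \<open>C\<^sup>*\<^sub>r(\<Gamma>)\<close> (\<open>reduced_algebra_limit_idempotent\<close>), which is \<open>0\<close> or \<open>1\<close> by hypothesis.

  \<^bold>\<open>Return to \<open>r\<close>.\<close> Hence the iterates converge pointwise to \<open>b = 0\<close> or to \<open>b = 1\<close>. They stay within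
  \<open>1/4\<close> of \<open>f\<close> in \<open>N\<^sub>r\<close>, and \<open>N\<^sub>r\<close> is lower semicontinuous for pointwise convergence
  (\<open>alg_norm_limit_le\<close>), so \<open>N\<^sub>r(f - b) \<le> 1/4\<close> and \<open>\<parallel>a - b\<parallel> \<le> 1/2\<close>. An idempotent that close to
  \<open>0\<close> or \<open>1\<close> is equal to it.
\<close>

section \<open>Norms on finite sets\<close>

lemma one_le_enn2real: "1 \<le> r \<Longrightarrow> r \<noteq> \<infinity> \<Longrightarrow> 1 \<le> enn2real r" for r :: ennreal
  using enn2real_mono[of 1 r] by (simp add: top.not_eq_extremum)

text \<open>The value \<open>0\<close> is inserted in the maximum so that the empty set has norm \<open>0\<close> for every exponent.
  The norm of \<open>\<ell>\<^sup>r(I)\<close> is the supremum of these norms over the finite subsets of \<open>I\<close> (lemmas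
  \<open>fin_norm_le_ell_norm\<close> and \<open>ell_norm_le\<close>), so the exponent \<open>\<infinity>\<close> and the question of summability are
  dealt with once, and all later estimates are uniform in \<open>r\<close>.\<close>

definition fin_norm :: "ennreal \<Rightarrow> 'a set \<Rightarrow> ('a \<Rightarrow> complex) \<Rightarrow> real" where
  "fin_norm r F \<xi> =
     (if r = \<infinity> then Max (insert 0 ((\<lambda>x. cmod (\<xi> x)) ` F))
      else (\<Sum>x\<in>F. cmod (\<xi> x) powr enn2real r) powr (1 / enn2real r))"

lemma fin_norm_infinity_le_iff:
  "r = \<infinity> \<Longrightarrow> finite F \<Longrightarrow> 0 \<le> a \<Longrightarrow> fin_norm r F \<xi> \<le> a \<longleftrightarrow> (\<forall>x\<in>F. cmod (\<xi> x) \<le> a)"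
  by (auto simp: fin_norm_def)

lemma fin_norm_finite_le_iff:
  assumes "1 \<le> r" "r \<noteq> \<infinity>" "0 \<le> a"
  shows "fin_norm r F \<xi> \<le> a \<longleftrightarrow> (\<Sum>x\<in>F. cmod (\<xi> x) powr enn2real r) \<le> a powr enn2real r"
proof -
  define s where "s = enn2real r"
  have s: "1 \<le> s" using assms one_le_enn2real s_def by auto
  let ?S = "\<Sum>x\<in>F. cmod (\<xi> x) powr s"
  have S0: "0 \<le> ?S" by (simp add: sum_nonneg)
  have "?S powr (1/s) \<le> a \<longleftrightarrow> ?S \<le> a powr s"
  proof
    assume "?S powr (1/s) \<le> a"
    from powr_mono2[OF _ _ this, of s] show "?S \<le> a powr s"
      using s S0 by (simp add: powr_powr)
  next
    assume "?S \<le> a powr s"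
    from powr_mono2[OF _ _ this, of "1/s"] show "?S powr (1/s) \<le> a"
      using s S0 assms(3) by (simp add: powr_powr)
  qed
  then show ?thesis using assms(2) by (simp add: fin_norm_def s_def)
qed

lemma fin_norm_nonneg [simp]: "finite F \<Longrightarrow> 0 \<le> fin_norm r F \<xi>"
  by (auto simp: fin_norm_def)

lemma fin_norm_scale:
  assumes "1 \<le> r" "finite F"
  shows "fin_norm r F (\<lambda>x. c * \<xi> x) = cmod c * fin_norm r F \<xi>"
proof (cases "r = \<infinity>")
  case True
  have "(\<lambda>t. cmod c * t) ` insert 0 ((\<lambda>x. cmod (\<xi> x)) ` F) = insert 0 ((\<lambda>x. cmod (c * \<xi> x)) ` F)"
    by (auto simp: norm_mult image_iff)
  moreover have "mono (\<lambda>t. cmod c * t)" by (auto intro!: monoI mult_left_mono)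
  ultimately show ?thesis using True assms(2)
    using mono_Max_commute[of "\<lambda>t. cmod c * t" "insert 0 ((\<lambda>x. cmod (\<xi> x)) ` F)"]
    by (simp add: fin_norm_def)
next
  case False
  then have s: "1 \<le> enn2real r" using assms one_le_enn2real by auto
  have "fin_norm r F (\<lambda>x. c * \<xi> x) = (cmod c powr enn2real r * (\<Sum>x\<in>F. cmod (\<xi> x) powr enn2real r)) powr (1 / enn2real r)"
    using False by (simp add: fin_norm_def norm_mult powr_mult sum_distrib_left)
  also have "\<dots> = cmod c * fin_norm r F \<xi>" using False s
    by (simp add: fin_norm_def powr_mult powr_powr sum_nonneg)
  finally show ?thesis .
qed

lemma fin_norm_reindex:
  "inj_on g F \<Longrightarrow> fin_norm r F (\<lambda>x. \<xi> (g x)) = fin_norm r (g ` F) \<xi>"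
  by (simp add: fin_norm_def sum.reindex image_image)

lemma fin_norm_cong:
  "(\<And>x. x \<in> F \<Longrightarrow> cmod (\<xi> x) = cmod (\<eta> x)) \<Longrightarrow> fin_norm r F \<xi> = fin_norm r F \<eta>"
  by (simp add: fin_norm_def cong: sum.cong image_cong_simp)

lemma fin_norm_singleton: "1 \<le> r \<Longrightarrow> fin_norm r {x} \<xi> = cmod (\<xi> x)"
  using one_le_enn2real[of r] by (auto simp: fin_norm_def powr_powr)

lemma fin_norm_subset:
  assumes "1 \<le> r" "finite F'" "F \<subseteq> F'"
  shows "fin_norm r F \<xi> \<le> fin_norm r F' \<xi>"
proof (cases "r = \<infinity>")
  case True
  then show ?thesis using assms by (auto simp: fin_norm_def intro!: Max_mono)
next
  case False
  then have "1 \<le> enn2real r" using assms one_le_enn2real by auto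
  then show ?thesis using False assms
    by (auto simp: fin_norm_def intro!: powr_mono2 sum_mono2 sum_nonneg)
qed

lemma powr_convex_nonneg:
  fixes x y t s :: real
  assumes "1 \<le> s" "0 \<le> x" "0 \<le> y" "0 \<le> t" "t \<le> 1"
  shows "((1 - t) * x + t * y) powr s \<le> (1 - t) * x powr s + t * y powr s"
proof -
  have small: "(u * z) powr s \<le> u * z powr s" if "0 \<le> u" "u \<le> 1" "0 \<le> z" for u z :: real
  proof -
    have "u powr s \<le> u"
    proof (cases "u = 0")
      case False
      then show ?thesis using powr_mono'[of 1 s u] that assms by simp
    qed auto
    then show ?thesis using that by (simp add: powr_mult mult_right_mono)
  qed
  consider "x = 0" | "y = 0" | "x > 0" "y > 0" using assms by linarith
  then show ?thesis
  proof cases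
    case 1 then show ?thesis using small[of t y] assms by simp
  next
    case 2 then show ?thesis using small[of "1 - t" x] assms by simp
  next
    case 3 then show ?thesis
      using convex_onD[OF powr_convex[OF assms(1)], of t x y] assms by simp
  qed
qed

text \<open>Minkowski's inequality. Enlarging both norms slightly to positive numbers \<open>a\<close> and \<open>b\<close> makes
  \<open>\<xi>/a\<close> and \<open>\<eta>/b\<close> vectors of norm at most \<open>1\<close>, and \<open>(\<xi> + \<eta>)/(a + b)\<close> is a convex combination of them;
  convexity of \<open>x \<mapsto> x\<^sup>s\<close> then shows that it has norm at most \<open>1\<close> as well.\<close>

lemma fin_norm_triangle:
  assumes r: "1 \<le> r" and F: "finite F"
  shows "fin_norm r F (\<lambda>x. \<xi> x + \<eta> x) \<le> fin_norm r F \<xi> + fin_norm r F \<eta>"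
proof (cases "r = \<infinity>")
  case True
  have "\<forall>x\<in>F. cmod (\<xi> x) \<le> fin_norm r F \<xi>" for \<xi> :: "'a \<Rightarrow> complex"
    using fin_norm_infinity_le_iff[OF True, of F "fin_norm r F \<xi>" \<xi>] F by simp
  then show ?thesis
    using F True by (subst fin_norm_infinity_le_iff) (auto intro!: norm_triangle_mono)
next
  case False
  define s where "s = enn2real r"
  have s: "1 \<le> s" using r False one_le_enn2real s_def by auto
  have "fin_norm r F (\<lambda>x. \<xi> x + \<eta> x) \<le> fin_norm r F \<xi> + fin_norm r F \<eta> + \<epsilon>" if "\<epsilon> > 0" for \<epsilon>
  proof -
    define a b where "a = fin_norm r F \<xi> + \<epsilon>/2" and "b = fin_norm r F \<eta> + \<epsilon>/2"
    have ab: "a > 0" "b > 0" using F that by (simp_all add: a_def b_def add_nonneg_pos)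
    have normalised: "(\<Sum>x\<in>F. (cmod (\<zeta> x) / c) powr s) \<le> 1"
      if "fin_norm r F \<zeta> \<le> c" "c > 0" for \<zeta> and c
    proof -
      have "(\<Sum>x\<in>F. cmod (\<zeta> x) powr s) \<le> c powr s"
        using fin_norm_finite_le_iff[OF r False, of c F \<zeta>] that by (simp add: s_def)
      moreover have "(\<Sum>x\<in>F. (cmod (\<zeta> x) / c) powr s) = (\<Sum>x\<in>F. cmod (\<zeta> x) powr s) / c powr s"
        using that by (simp add: powr_divide sum_divide_distrib)
      ultimately show ?thesis using that by simp
    qed
    define t where "t = b / (a + b)"
    have t: "0 \<le> t" "t \<le> 1" "1 - t = a / (a + b)" using ab by (auto simp: t_def field_simps)
    have "cmod (\<xi> x + \<eta> x) powr s \<le>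
        (a + b) powr s * ((1 - t) * (cmod (\<xi> x) / a) powr s + t * (cmod (\<eta> x) / b) powr s)" for x
    proof -
      have "cmod (\<xi> x + \<eta> x) \<le> (a + b) * ((1 - t) * (cmod (\<xi> x) / a) + t * (cmod (\<eta> x) / b))"
      proof -
        have "(a + b) * (1 - t) = a" using ab unfolding t(3) by simp
        moreover have "(a + b) * t = b" using ab unfolding t_def by simp
        ultimately have "(a + b) * ((1 - t) * (cmod (\<xi> x) / a) + t * (cmod (\<eta> x) / b))
            = a * (cmod (\<xi> x) / a) + b * (cmod (\<eta> x) / b)"
          by (simp only: distrib_left mult.assoc[symmetric])
        also have "\<dots> = cmod (\<xi> x) + cmod (\<eta> x)" using ab by simp
        finally show ?thesis using norm_triangle_ineq[of "\<xi> x" "\<eta> x"] by linarith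
      qed
      then have "cmod (\<xi> x + \<eta> x) powr s
          \<le> ((a + b) * ((1 - t) * (cmod (\<xi> x) / a) + t * (cmod (\<eta> x) / b))) powr s"
        using s by (intro powr_mono2) simp_all
      also have "\<dots> = (a + b) powr s * ((1 - t) * (cmod (\<xi> x) / a) + t * (cmod (\<eta> x) / b)) powr s"
        by (rule powr_mult)
      also have "\<dots> \<le> (a + b) powr s * ((1 - t) * (cmod (\<xi> x) / a) powr s + t * (cmod (\<eta> x) / b) powr s)"
        using ab(1,2) t(1,2) s
        by (intro mult_left_mono powr_convex_nonneg) (simp_all add: less_imp_le)
      finally show ?thesis .
    qed
    then have "(\<Sum>x\<in>F. cmod (\<xi> x + \<eta> x) powr s) \<le> (\<Sum>x\<in>F.
        (a + b) powr s * ((1 - t) * (cmod (\<xi> x) / a) powr s + t * (cmod (\<eta> x) / b) powr s))"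
      by (intro sum_mono)
    also have "\<dots> = (a + b) powr s * ((1 - t) * (\<Sum>x\<in>F. (cmod (\<xi> x) / a) powr s)
        + t * (\<Sum>x\<in>F. (cmod (\<eta> x) / b) powr s))"
      by (simp add: sum_distrib_left sum.distrib distrib_left)
    also have "\<dots> \<le> (a + b) powr s * ((1 - t) * 1 + t * 1)"
    proof -
      have "fin_norm r F \<xi> \<le> a" "fin_norm r F \<eta> \<le> b" using that by (simp_all add: a_def b_def)
      then have "(\<Sum>x\<in>F. (cmod (\<xi> x) / a) powr s) \<le> 1" "(\<Sum>x\<in>F. (cmod (\<eta> x) / b) powr s) \<le> 1"
        using ab normalised by blast+
      then show ?thesis using t(1,2) by (intro mult_left_mono add_mono) simp_all
    qed
    finally have "(\<Sum>x\<in>F. cmod (\<xi> x + \<eta> x) powr s) \<le> (a + b) powr s" by simp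
    moreover have "0 \<le> a + b" using ab by linarith
    ultimately have "fin_norm r F (\<lambda>x. \<xi> x + \<eta> x) \<le> a + b"
      unfolding s_def by (rule iffD2[OF fin_norm_finite_le_iff[OF r False], rotated])
    then show ?thesis using a_def b_def by linarith
  qed
  then show ?thesis by (rule field_le_epsilon)
qed

lemma tendsto_fin_norm:
  assumes "1 \<le> r" "finite F" "\<And>x. x \<in> F \<Longrightarrow> ((\<lambda>n. \<xi> n x) \<longlongrightarrow> \<eta> x) sequentially"
    and "\<And>n. fin_norm r F (\<xi> n) \<le> K n" and "(K \<longlongrightarrow> k) sequentially"
  shows "fin_norm r F \<eta> \<le> k"
proof -
  have K0: "0 \<le> K n" for n using assms(4)[of n] fin_norm_nonneg[OF assms(2), of r "\<xi> n"] by linarith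
  have k0: "0 \<le> k" by (rule LIMSEQ_le_const[OF assms(5)]) (use K0 in auto)
  show ?thesis
  proof (cases "r = \<infinity>")
    case True
    have "cmod (\<eta> x) \<le> k" if "x \<in> F" for x
    proof (rule LIMSEQ_le[OF tendsto_norm[OF assms(3)[OF that]] assms(5)])
      show "\<exists>N. \<forall>n\<ge>N. cmod (\<xi> n x) \<le> K n"
        using assms(4) fin_norm_infinity_le_iff[OF True assms(2) K0] that by blast
    qed
    then show ?thesis using True k0 assms(2) by (simp add: fin_norm_infinity_le_iff)
  next
    case False
    define s where "s = enn2real r"
    have s: "1 \<le> s" using assms False one_le_enn2real s_def by auto
    have "(\<Sum>x\<in>F. cmod (\<eta> x) powr s) \<le> k powr s"
    proof (rule LIMSEQ_le)
      show "(\<lambda>n. \<Sum>x\<in>F. cmod (\<xi> n x) powr s) \<longlonglongrightarrow> (\<Sum>x\<in>F. cmod (\<eta> x) powr s)"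
        using s by (intro tendsto_sum tendsto_powr2 tendsto_norm assms(3) tendsto_const) auto
      show "(\<lambda>n. K n powr s) \<longlonglongrightarrow> k powr s"
        using s K0 by (intro tendsto_powr2 assms(5) tendsto_const) auto
      have "(\<Sum>x\<in>F. cmod (\<xi> n x) powr s) \<le> K n powr s" for n
        unfolding s_def by (rule iffD1[OF fin_norm_finite_le_iff[OF assms(1) False K0] assms(4)])
      then show "\<exists>N. \<forall>n\<ge>N. (\<Sum>x\<in>F. cmod (\<xi> n x) powr s) \<le> K n powr s"
        by simp
    qed
    then show ?thesis using fin_norm_finite_le_iff[OF assms(1) False k0, of F \<eta>] by (simp add: s_def)
  qed
qed

section \<open>The spaces \<open>\<ell>\<^sup>r\<close> and their operators\<close>

lemma ell_iff:
  assumes "1 \<le> r"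
  shows "\<xi> \<in> ell r I \<longleftrightarrow> (\<forall>x. x \<notin> I \<longrightarrow> \<xi> x = 0) \<and>
    (\<exists>K. \<forall>F. finite F \<and> F \<subseteq> I \<longrightarrow> fin_norm r F \<xi> \<le> K)"
proof (cases "r = \<infinity>")
  case True
  have "bounded (\<xi> ` I) \<longleftrightarrow> (\<exists>K. \<forall>F. finite F \<and> F \<subseteq> I \<longrightarrow> fin_norm r F \<xi> \<le> K)" (is "?L \<longleftrightarrow> ?R")
  proof
    assume ?L
    then obtain B where "B > 0" "\<forall>x\<in>I. cmod (\<xi> x) \<le> B" unfolding bounded_pos by auto
    then show ?R using True by (intro exI[of _ B]) (auto simp: fin_norm_infinity_le_iff)
  next
    assume ?R
    then obtain K where K: "\<And>F. finite F \<Longrightarrow> F \<subseteq> I \<Longrightarrow> fin_norm r F \<xi> \<le> K" by auto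
    have "cmod (\<xi> x) \<le> K" if "x \<in> I" for x
      using K[of "{x}"] that fin_norm_singleton[OF assms, of x \<xi>] by auto
    then show ?L unfolding bounded_iff by auto
  qed
  then show ?thesis using True by (auto simp: ell_def)
next
  case False
  define s where "s = enn2real r"
  let ?f = "\<lambda>x. cmod (\<xi> x) powr s"
  have "?f summable_on I \<longleftrightarrow> (\<exists>K. \<forall>F. finite F \<and> F \<subseteq> I \<longrightarrow> fin_norm r F \<xi> \<le> K)" (is "?L \<longleftrightarrow> ?R")
  proof
    assume ?L
    have "fin_norm r F \<xi> \<le> infsum ?f I powr (1 / s)" if "finite F" "F \<subseteq> I" for F
    proof -
      have "sum ?f F \<le> infsum ?f I" using that \<open>?L\<close> by (intro finite_sum_le_infsum) auto
      then show ?thesis using False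
        by (auto simp: fin_norm_def s_def intro!: powr_mono2 sum_nonneg)
    qed
    then show ?R by auto
  next
    assume ?R
    then obtain K where K: "\<And>F. finite F \<Longrightarrow> F \<subseteq> I \<Longrightarrow> fin_norm r F \<xi> \<le> K" by auto
    have K0: "0 \<le> K" by (rule order_trans[OF fin_norm_nonneg K[of "{}"]]) auto
    show ?L
    proof (rule nonneg_bdd_above_summable_on)
      show "bdd_above (sum ?f ` {F. F \<subseteq> I \<and> finite F})"
        using K fin_norm_finite_le_iff[OF assms False K0]
        by (intro bdd_aboveI[of _ "K powr s"]) (auto simp: s_def)
    qed auto
  qed
  then show ?thesis using False by (auto simp: ell_def s_def)
qed

lemma fin_norm_le_ell_norm:
  assumes r: "1 \<le> r" and xi: "\<xi> \<in> ell r I" and F: "finite F" "F \<subseteq> I" "I \<noteq> {}"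
  shows "fin_norm r F \<xi> \<le> ell_norm r I \<xi>"
proof (cases "r = \<infinity>")
  case True
  have bdd: "bdd_above ((\<lambda>x. cmod (\<xi> x)) ` I)"
    using xi True by (auto simp: ell_def bdd_above_def bounded_iff)
  have le: "cmod (\<xi> x) \<le> (SUP x\<in>I. cmod (\<xi> x))" if "x \<in> I" for x
    by (rule cSUP_upper[OF that bdd])
  moreover have "0 \<le> (SUP x\<in>I. cmod (\<xi> x))"
    using F(3) le norm_ge_zero order_trans by (metis ex_in_conv)
  ultimately show ?thesis using True F
    by (auto simp: fin_norm_infinity_le_iff ell_norm_def)
next
  case False
  have "(\<lambda>x. cmod (\<xi> x) powr enn2real r) summable_on I" using xi False by (simp add: ell_def)
  then have "(\<Sum>x\<in>F. cmod (\<xi> x) powr enn2real r) \<le> (\<Sum>\<^sub>\<infinity>x\<in>I. cmod (\<xi> x) powr enn2real r)"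
    using F by (intro finite_sum_le_infsum) auto
  then show ?thesis using False
    by (auto simp: fin_norm_def ell_norm_def intro!: powr_mono2 sum_nonneg)
qed

lemma ell_norm_le:
  assumes r: "1 \<le> r" and I: "I \<noteq> {}"
    and le: "\<And>F. finite F \<Longrightarrow> F \<subseteq> I \<Longrightarrow> fin_norm r F \<xi> \<le> K"
  shows "ell_norm r I \<xi> \<le> K"
proof (cases "r = \<infinity>")
  case True
  have "cmod (\<xi> x) \<le> K" if "x \<in> I" for x
    using le[of "{x}"] that fin_norm_singleton[OF r, of x \<xi>] by auto
  then show ?thesis using True I by (auto simp: ell_norm_def intro!: cSUP_least)
next
  case False
  define s where "s = enn2real r"
  have s: "1 \<le> s" using r False one_le_enn2real s_def by auto
  let ?f = "\<lambda>x. cmod (\<xi> x) powr s"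
  have K0: "0 \<le> K" by (rule order_trans[OF fin_norm_nonneg le[of "{}"]]) auto
  have fin: "sum ?f F \<le> K powr s" if "finite F" "F \<subseteq> I" for F
    using le[OF that] fin_norm_finite_le_iff[OF r False K0, of F \<xi>] by (simp add: s_def)
  have "?f summable_on I"
    by (rule nonneg_bdd_above_summable_on) (use fin in \<open>auto intro!: bdd_aboveI[of _ "K powr s"]\<close>)
  then have "infsum ?f I \<le> K powr s"
    using fin by (intro infsum_le_finite_sums) auto
  then have "infsum ?f I powr (1 / s) \<le> (K powr s) powr (1 / s)"
    using s by (intro powr_mono2 infsum_nonneg) auto
  then show ?thesis using False s K0 by (simp add: ell_norm_def s_def powr_powr)
qed

lemma ell_zero_outside: "\<xi> \<in> ell r I \<Longrightarrow> x \<notin> I \<Longrightarrow> \<xi> x = 0"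
  by (simp add: ell_def)

lemma ell_boundedI:
  assumes "1 \<le> r" "I \<noteq> {}" "\<And>x. x \<notin> I \<Longrightarrow> \<xi> x = 0"
    and "\<And>F. finite F \<Longrightarrow> F \<subseteq> I \<Longrightarrow> fin_norm r F \<xi> \<le> K"
  shows "\<xi> \<in> ell r I" and "ell_norm r I \<xi> \<le> K"
  using assms(3,4) ell_norm_le[OF assms(1,2,4)] by (auto simp: ell_iff[OF assms(1)])

lemma ell_norm_nonneg:
  assumes "1 \<le> r" "I \<noteq> {}" "\<xi> \<in> ell r I"
  shows "0 \<le> ell_norm r I \<xi>"
  using fin_norm_le_ell_norm[OF assms(1,3), of "{}"] assms(2) fin_norm_nonneg[of "{}" r \<xi>]
  by (meson empty_subsetI finite.emptyI order_trans)

lemma cmod_le_ell_norm: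
  assumes "1 \<le> r" "I \<noteq> {}" "\<xi> \<in> ell r I"
  shows "cmod (\<xi> x) \<le> ell_norm r I \<xi>"
proof (cases "x \<in> I")
  case True
  then show ?thesis
    using fin_norm_le_ell_norm[OF assms(1,3), of "{x}"] fin_norm_singleton[OF assms(1), of x \<xi>]
    by auto
next
  case False
  then show ?thesis using ell_zero_outside[OF assms(3)] ell_norm_nonneg[OF assms] by simp
qed

lemma ell_add:
  assumes r: "1 \<le> r" and I: "I \<noteq> {}" and xi: "\<xi> \<in> ell r I" and eta: "\<eta> \<in> ell r I"
  shows "(\<lambda>x. \<xi> x + \<eta> x) \<in> ell r I"
    and "ell_norm r I (\<lambda>x. \<xi> x + \<eta> x) \<le> ell_norm r I \<xi> + ell_norm r I \<eta>"
proof -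
  have "fin_norm r F (\<lambda>x. \<xi> x + \<eta> x) \<le> ell_norm r I \<xi> + ell_norm r I \<eta>"
    if "finite F" "F \<subseteq> I" for F
    using fin_norm_triangle[OF r that(1), of \<xi> \<eta>] fin_norm_le_ell_norm[OF r xi that I]
      fin_norm_le_ell_norm[OF r eta that I] by linarith
  note bd = this
  show "(\<lambda>x. \<xi> x + \<eta> x) \<in> ell r I"
    by (rule ell_boundedI(1)[OF r I _ bd]) (simp_all add: ell_zero_outside[OF xi] ell_zero_outside[OF eta])
  show "ell_norm r I (\<lambda>x. \<xi> x + \<eta> x) \<le> ell_norm r I \<xi> + ell_norm r I \<eta>"
    by (rule ell_norm_le[OF r I bd])
qed

lemma ell_scale:
  assumes r: "1 \<le> r" and I: "I \<noteq> {}" and xi: "\<xi> \<in> ell r I"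
  shows "(\<lambda>x. c * \<xi> x) \<in> ell r I"
    and "ell_norm r I (\<lambda>x. c * \<xi> x) \<le> cmod c * ell_norm r I \<xi>"
proof -
  have bd: "fin_norm r F (\<lambda>x. c * \<xi> x) \<le> cmod c * ell_norm r I \<xi>" if "finite F" "F \<subseteq> I" for F
    unfolding fin_norm_scale[OF r that(1)]
    by (intro mult_left_mono fin_norm_le_ell_norm[OF r xi that I]) simp
  show "(\<lambda>x. c * \<xi> x) \<in> ell r I"
    by (rule ell_boundedI(1)[OF r I _ bd]) (simp_all add: ell_zero_outside[OF xi])
  show "ell_norm r I (\<lambda>x. c * \<xi> x) \<le> cmod c * ell_norm r I \<xi>"
    by (rule ell_norm_le[OF r I bd])
qed

lemma ell_diff:
  assumes "1 \<le> r" "I \<noteq> {}" "\<xi> \<in> ell r I" "\<eta> \<in> ell r I"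
  shows "(\<lambda>x. \<xi> x - \<eta> x) \<in> ell r I"
    and "ell_norm r I (\<lambda>x. \<xi> x - \<eta> x) \<le> ell_norm r I \<xi> + ell_norm r I \<eta>"
  using ell_add[OF assms(1,2,3) ell_scale(1)[OF assms(1,2,4), of "-1"]]
    ell_scale(2)[OF assms(1,2,4), of "-1"] by auto

lemma ell_norm_diff_commute:
  "ell_norm r I (\<lambda>x. \<xi> x - \<eta> x) = ell_norm r I (\<lambda>x. \<eta> x - \<xi> x)"
  by (simp add: ell_norm_def norm_minus_commute)

lemma ell_zero: "(\<lambda>x. 0) \<in> ell r I"
  by (auto simp: ell_def image_constant_conv)

lemma ell_norm_zero: "I \<noteq> {} \<Longrightarrow> ell_norm r I (\<lambda>x. 0) = 0"
  by (simp add: ell_norm_def)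

lemma ell_norm_eq_0:
  assumes "1 \<le> r" "I \<noteq> {}" "\<xi> \<in> ell r I" "ell_norm r I \<xi> \<le> 0"
  shows "\<xi> = (\<lambda>x. 0)"
proof
  fix x show "\<xi> x = 0" using order_trans[OF cmod_le_ell_norm[OF assms(1-3)] assms(4)] by simp
qed

lemma ell_norm_finite_support:
  assumes r: "1 \<le> r" and I: "I \<noteq> {}" and F: "finite F" "F \<subseteq> I" "\<And>x. x \<notin> F \<Longrightarrow> \<xi> x = 0"
  shows "\<xi> \<in> ell r I" and "ell_norm r I \<xi> = fin_norm r F \<xi>"
proof -
  have bd: "fin_norm r F' \<xi> \<le> fin_norm r F \<xi>" if "finite F'" "F' \<subseteq> I" for F'
  proof -
    have "fin_norm r F' \<xi> = fin_norm r (F' \<inter> F) \<xi>"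
    proof (cases "r = \<infinity>")
      case True
      have "insert 0 ((\<lambda>x. cmod (\<xi> x)) ` F') - {0} = insert 0 ((\<lambda>x. cmod (\<xi> x)) ` (F' \<inter> F)) - {0}"
        using F(3) by force
      then have "insert 0 ((\<lambda>x. cmod (\<xi> x)) ` F') = insert 0 ((\<lambda>x. cmod (\<xi> x)) ` (F' \<inter> F))"
        by (metis insert_Diff_single insert_absorb2)
      then show ?thesis using True by (simp add: fin_norm_def)
    next
      case False
      have "(\<Sum>x\<in>F'. cmod (\<xi> x) powr enn2real r) = (\<Sum>x\<in>F' \<inter> F. cmod (\<xi> x) powr enn2real r)"
        using that F(3) by (intro sum.mono_neutral_right) simp_all
      then show ?thesis using False by (simp add: fin_norm_def)
    qed
    also have "\<dots> \<le> fin_norm r F \<xi>" by (rule fin_norm_subset[OF r F(1)]) auto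
    finally show ?thesis .
  qed
  show ell: "\<xi> \<in> ell r I"
    by (rule ell_boundedI(1)[OF r I _ bd]) (use F in auto)
  show "ell_norm r I \<xi> = fin_norm r F \<xi>"
    using ell_norm_le[OF r I bd] fin_norm_le_ell_norm[OF r ell F(1,2) I] by (rule antisym)
qed

text \<open>Fatou's lemma in the form used throughout: for each finite set the norm is continuous in the
  values, so a bound survives pointwise limits, and membership in \<open>\<ell>\<^sup>r\<close> comes with it.\<close>

lemma ell_norm_limit_le:
  assumes r: "1 \<le> r" and I: "I \<noteq> {}" and "\<And>x. x \<notin> I \<Longrightarrow> \<eta> x = 0"
    and "\<And>n. \<xi> n \<in> ell r I" "\<And>n. ell_norm r I (\<xi> n) \<le> K n" "K \<longlonglongrightarrow> k"
    and "\<And>x. x \<in> I \<Longrightarrow> (\<lambda>n. \<xi> n x) \<longlonglongrightarrow> \<eta> x"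
  shows "\<eta> \<in> ell r I" and "ell_norm r I \<eta> \<le> k"
proof -
  have bd: "fin_norm r F \<eta> \<le> k" if "finite F" "F \<subseteq> I" for F
  proof (rule tendsto_fin_norm[OF r that(1) _ _ assms(6)])
    show "(\<lambda>n. \<xi> n x) \<longlonglongrightarrow> \<eta> x" if "x \<in> F" for x using assms(7) that \<open>F \<subseteq> I\<close> by auto
    show "fin_norm r F (\<xi> n) \<le> K n" for n
      using fin_norm_le_ell_norm[OF r assms(4) that I] assms(5) by (rule order_trans)
  qed
  show "\<eta> \<in> ell r I" by (rule ell_boundedI(1)[OF r I assms(3) bd])
  show "ell_norm r I \<eta> \<le> k" by (rule ell_norm_le[OF r I bd])
qed

lemma op_norm_le:
  assumes "1 \<le> r" "I \<noteq> {}" "0 \<le> K"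
    and "\<And>\<xi>. \<xi> \<in> ell r I \<Longrightarrow> ell_norm r I (T \<xi>) \<le> K * ell_norm r I \<xi>"
  shows "op_norm r I T \<le> K"
  unfolding op_norm_def
proof (rule cSup_least)
  show "{ell_norm r I (T \<xi>) |\<xi>. \<xi> \<in> ell r I \<and> ell_norm r I \<xi> \<le> 1} \<noteq> {}"
    using ell_zero[of r I] ell_norm_zero[OF assms(2), of r] by force
  fix x assume "x \<in> {ell_norm r I (T \<xi>) |\<xi>. \<xi> \<in> ell r I \<and> ell_norm r I \<xi> \<le> 1}"
  then obtain \<xi> where xi: "x = ell_norm r I (T \<xi>)" "\<xi> \<in> ell r I" "ell_norm r I \<xi> \<le> 1" by auto
  have "K * ell_norm r I \<xi> \<le> K * 1" using xi assms(3) by (intro mult_left_mono)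
  then show "x \<le> K" using xi assms(4)[OF xi(2)] by simp
qed

text \<open>The supremum in \<open>op_norm\<close> runs over the unit ball only, so homogeneity is needed to rescale \<open>\<xi>\<close>,
  and some bound \<open>K\<close> is needed for the supremum to be meaningful.\<close>

lemma ell_norm_le_op_norm:
  assumes r: "1 \<le> r" and I: "I \<noteq> {}"
    and T: "\<And>\<xi>. \<xi> \<in> ell r I \<Longrightarrow> T \<xi> \<in> ell r I"
    and hom: "\<And>c \<xi>. \<xi> \<in> ell r I \<Longrightarrow> T (\<lambda>x. c * \<xi> x) = (\<lambda>x. c * T \<xi> x)"
    and bd: "\<And>\<xi>. \<xi> \<in> ell r I \<Longrightarrow> ell_norm r I (T \<xi>) \<le> K * ell_norm r I \<xi>"
    and xi: "\<xi> \<in> ell r I"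
  shows "ell_norm r I (T \<xi>) \<le> op_norm r I T * ell_norm r I \<xi>"
proof (cases "ell_norm r I \<xi> = 0")
  case True
  then show ?thesis using bd[OF xi] by simp
next
  case False
  define a where "a = ell_norm r I \<xi>"
  have a: "a > 0" using False ell_norm_nonneg[OF r I xi] by (simp add: a_def)
  define \<zeta> where "\<zeta> = (\<lambda>x. complex_of_real (1/a) * \<xi> x)"
  have z: "\<zeta> \<in> ell r I" unfolding \<zeta>_def by (rule ell_scale(1)[OF r I xi])
  have z1: "ell_norm r I \<zeta> \<le> 1"
    using ell_scale(2)[OF r I xi, of "complex_of_real (1/a)"] a
    by (simp add: \<zeta>_def a_def[symmetric] norm_divide)
  have "bdd_above {ell_norm r I (T \<xi>) |\<xi>. \<xi> \<in> ell r I \<and> ell_norm r I \<xi> \<le> 1}"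
  proof (rule bdd_aboveI[of _ "\<bar>K\<bar>"])
    fix x assume "x \<in> {ell_norm r I (T \<xi>) |\<xi>. \<xi> \<in> ell r I \<and> ell_norm r I \<xi> \<le> 1}"
    then obtain \<xi> where xi: "x = ell_norm r I (T \<xi>)" "\<xi> \<in> ell r I" "ell_norm r I \<xi> \<le> 1" by auto
    have "K * ell_norm r I \<xi> \<le> \<bar>K\<bar> * 1"
      using xi ell_norm_nonneg[OF r I xi(2)] by (intro mult_mono) auto
    then show "x \<le> \<bar>K\<bar>" using xi bd[OF xi(2)] by simp
  qed
  then have Tz: "ell_norm r I (T \<zeta>) \<le> op_norm r I T"
    unfolding op_norm_def using z z1 by (intro cSup_upper) auto
  have "T \<xi> = T (\<lambda>x. complex_of_real a * \<zeta> x)"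
    using a by (simp add: \<zeta>_def mult.assoc[symmetric] flip: of_real_mult)
  also have "\<dots> = (\<lambda>x. complex_of_real a * T \<zeta> x)" by (rule hom[OF z])
  finally have "ell_norm r I (T \<xi>) \<le> a * ell_norm r I (T \<zeta>)"
    using ell_scale(2)[OF r I T[OF z], of "complex_of_real a"] a by simp
  also have "\<dots> \<le> a * op_norm r I T" using Tz a by simp
  finally show ?thesis by (simp add: a_def mult.commute)
qed

section \<open>Convolution\<close>

text \<open>The sum is taken over the support of \<open>f\<close>, so \<open>\<xi>\<close> may be any function. This is the action of
  \<open>left_regular_alg\<close>, stripped of its dependence on the exponent.\<close>

definition conv :: "('a, 'm) monoid_scheme \<Rightarrow> ('a \<Rightarrow> complex) \<Rightarrow> ('a \<Rightarrow> complex) \<Rightarrow> 'a \<Rightarrow> complex" where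
  "conv G f \<xi> = (\<lambda>\<alpha>. if \<alpha> \<in> carrier G
     then \<Sum>\<gamma>\<in>{\<gamma>. f \<gamma> \<noteq> 0}. f \<gamma> * \<xi> (inv\<^bsub>G\<^esub> \<gamma> \<otimes>\<^bsub>G\<^esub> \<alpha>) else 0)"

definition unit_delta :: "('a, 'm) monoid_scheme \<Rightarrow> 'a \<Rightarrow> complex" where
  "unit_delta G = (\<lambda>\<alpha>. if \<alpha> = \<one>\<^bsub>G\<^esub> then 1 else 0)"

abbreviation alg_norm :: "('a, 'm) monoid_scheme \<Rightarrow> ennreal \<Rightarrow> ('a \<Rightarrow> complex) \<Rightarrow> real" where
  "alg_norm G r f \<equiv> op_norm r (carrier G) (left_regular_alg G r f)"

lemma group_algebraI:
  "finite F \<Longrightarrow> F \<subseteq> carrier G \<Longrightarrow> (\<And>x. x \<notin> F \<Longrightarrow> f x = 0) \<Longrightarrow> f \<in> group_algebra G"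
  unfolding group_algebra_def by (auto elim!: rev_finite_subset)

lemma group_algebra_lincomb:
  assumes "f \<in> group_algebra G" "g \<in> group_algebra G"
  shows "(\<lambda>x. a * f x + b * g x) \<in> group_algebra G"
  using assms by (intro group_algebraI[of "{x. f x \<noteq> 0} \<union> {x. g x \<noteq> 0}"]) (auto simp: group_algebra_def)

lemma group_algebra_diff:
  "f \<in> group_algebra G \<Longrightarrow> g \<in> group_algebra G \<Longrightarrow> (\<lambda>x. f x - g x) \<in> group_algebra G"
  using group_algebra_lincomb[of f G g 1 "-1"] by simp

lemma conv_eq_sum:
  assumes "finite S" "{\<gamma>. f \<gamma> \<noteq> 0} \<subseteq> S" "\<alpha> \<in> carrier G"
  shows "conv G f \<xi> \<alpha> = (\<Sum>\<gamma>\<in>S. f \<gamma> * \<xi> (inv\<^bsub>G\<^esub> \<gamma> \<otimes>\<^bsub>G\<^esub> \<alpha>))"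
  using assms by (auto simp: conv_def intro!: sum.mono_neutral_left)

lemma conv_lincomb_right:
  "conv G f (\<lambda>x. a * \<xi> x + b * \<eta> x) = (\<lambda>\<alpha>. a * conv G f \<xi> \<alpha> + b * conv G f \<eta> \<alpha>)"
  by (auto simp: conv_def fun_eq_iff sum_distrib_left sum.distrib algebra_simps)

lemma conv_diff_right:
  "conv G f (\<lambda>x. \<xi> x - \<eta> x) = (\<lambda>\<alpha>. conv G f \<xi> \<alpha> - conv G f \<eta> \<alpha>)"
  using conv_lincomb_right[of G f 1 \<xi> "-1" \<eta>] by simp

lemma conv_lincomb_left:
  assumes "f \<in> group_algebra G" "g \<in> group_algebra G"
  shows "conv G (\<lambda>x. a * f x + b * g x) \<xi> = (\<lambda>\<alpha>. a * conv G f \<xi> \<alpha> + b * conv G g \<xi> \<alpha>)"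
proof
  fix \<alpha>
  define S where "S = {x. f x \<noteq> 0} \<union> {x. g x \<noteq> 0}"
  have S: "finite S" "{x. f x \<noteq> 0} \<subseteq> S" "{x. g x \<noteq> 0} \<subseteq> S" "{x. a * f x + b * g x \<noteq> 0} \<subseteq> S"
    using assms by (auto simp: S_def group_algebra_def)
  show "conv G (\<lambda>x. a * f x + b * g x) \<xi> \<alpha> = a * conv G f \<xi> \<alpha> + b * conv G g \<xi> \<alpha>"
  proof (cases "\<alpha> \<in> carrier G")
    case True
    then show ?thesis
      by (simp add: conv_eq_sum[OF S(1,2)] conv_eq_sum[OF S(1,3)] conv_eq_sum[OF S(1,4)]
          sum_distrib_left sum.distrib algebra_simps)
  qed (simp add: conv_def)
qed

lemma conv_diff_left:
  assumes "f \<in> group_algebra G" "g \<in> group_algebra G"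
  shows "conv G (\<lambda>x. f x - g x) \<xi> = (\<lambda>\<alpha>. conv G f \<xi> \<alpha> - conv G g \<xi> \<alpha>)"
  using conv_lincomb_left[OF assms, of 1 "-1" \<xi>] by simp

lemma conv_outside: "\<alpha> \<notin> carrier G \<Longrightarrow> conv G f \<xi> \<alpha> = 0"
  by (simp add: conv_def)

lemma left_regular_alg_eq_conv:
  assumes "f \<in> group_algebra G" "\<xi> \<in> ell r (carrier G)"
  shows "left_regular_alg G r f \<xi> = conv G f \<xi>"
  using assms by (auto simp: left_regular_alg_def left_regular_def conv_def fun_eq_iff)

context group
begin

lemma left_translation_inj: "\<gamma> \<in> carrier G \<Longrightarrow> inj_on (\<lambda>\<alpha>. \<gamma> \<otimes> \<alpha>) (carrier G)"
  using Units_l_cancel Units_eq by (intro inj_onI) blast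

lemma conv_support:
  assumes f: "f \<in> group_algebra G" and "conv G f \<xi> \<alpha> \<noteq> 0"
  obtains \<gamma> \<beta> where "\<gamma> \<in> carrier G" "\<beta> \<in> carrier G" "f \<gamma> \<noteq> 0" "\<xi> \<beta> \<noteq> 0" "\<alpha> = \<gamma> \<otimes> \<beta>"
proof -
  have a: "\<alpha> \<in> carrier G" using assms(2) by (auto simp: conv_def split: if_splits)
  with assms(2) obtain \<gamma> where g: "f \<gamma> \<noteq> 0" "\<xi> (inv \<gamma> \<otimes> \<alpha>) \<noteq> 0"
    by (auto simp: conv_def elim!: sum.not_neutral_contains_not_neutral)
  then have "\<gamma> \<in> carrier G" using f by (auto simp: group_algebra_def)
  moreover have "\<alpha> = \<gamma> \<otimes> (inv \<gamma> \<otimes> \<alpha>)"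
    using a calculation m_assoc[of \<gamma> "inv \<gamma>" \<alpha>] by simp
  ultimately show ?thesis using a g that[of \<gamma> "inv \<gamma> \<otimes> \<alpha>"] by simp
qed

lemma group_algebra_conv:
  assumes f: "f \<in> group_algebra G" and g: "g \<in> group_algebra G"
  shows "conv G f g \<in> group_algebra G"
proof (rule group_algebraI)
  show "finite ((\<lambda>(\<gamma>, \<delta>). \<gamma> \<otimes> \<delta>) ` ({\<gamma>. f \<gamma> \<noteq> 0} \<times> {\<delta>. g \<delta> \<noteq> 0}))"
    using f g by (auto simp: group_algebra_def)
  show "(\<lambda>(\<gamma>, \<delta>). \<gamma> \<otimes> \<delta>) ` ({\<gamma>. f \<gamma> \<noteq> 0} \<times> {\<delta>. g \<delta> \<noteq> 0}) \<subseteq> carrier G"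
    using f g by (auto simp: group_algebra_def)
  show "conv G f g x = 0" if "x \<notin> (\<lambda>(\<gamma>, \<delta>). \<gamma> \<otimes> \<delta>) ` ({\<gamma>. f \<gamma> \<noteq> 0} \<times> {\<delta>. g \<delta> \<noteq> 0})" for x
  proof (rule ccontr)
    assume "conv G f g x \<noteq> 0"
    from conv_support[OF f this] obtain \<gamma> \<beta> where "f \<gamma> \<noteq> 0" "g \<beta> \<noteq> 0" "x = \<gamma> \<otimes> \<beta>" by blast
    then show False using that by force
  qed
qed

text \<open>The change of variables \<open>\<alpha> = \<gamma>\<beta>\<close>, stated with an ambient finite set \<open>S\<close> that does not depend on \<open>\<gamma>\<close>,
  so that it can be used after interchanging two sums.\<close>

lemma sum_translate:
  fixes h k :: "'a \<Rightarrow> complex"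
  assumes g: "\<gamma> \<in> carrier G" and S: "finite S" "S \<subseteq> carrier G" and B: "B \<subseteq> carrier G"
    and supp: "\<And>\<beta>. \<beta> \<notin> B \<Longrightarrow> h \<beta> = 0" and sub: "(\<otimes>) \<gamma> ` B \<subseteq> S"
  shows "(\<Sum>\<alpha>\<in>S. h (inv \<gamma> \<otimes> \<alpha>) * k \<alpha>) = (\<Sum>\<beta>\<in>B. h \<beta> * k (\<gamma> \<otimes> \<beta>))"
proof -
  have "(\<Sum>\<beta>\<in>B. h \<beta> * k (\<gamma> \<otimes> \<beta>)) = (\<Sum>\<beta>\<in>B. h (inv \<gamma> \<otimes> (\<gamma> \<otimes> \<beta>)) * k (\<gamma> \<otimes> \<beta>))"
    using g B by (intro sum.cong) (auto simp: m_assoc[symmetric])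
  also have "\<dots> = (\<Sum>\<alpha>\<in>(\<otimes>) \<gamma> ` B. h (inv \<gamma> \<otimes> \<alpha>) * k \<alpha>)"
    by (simp add: sum.reindex[OF inj_on_subset[OF left_translation_inj[OF g] B]])
  also have "\<dots> = (\<Sum>\<alpha>\<in>S. h (inv \<gamma> \<otimes> \<alpha>) * k \<alpha>)"
  proof (rule sum.mono_neutral_left[OF S(1) sub], rule ballI)
    fix \<alpha> assume r: "\<alpha> \<in> S - (\<otimes>) \<gamma> ` B"
    then have "\<alpha> = \<gamma> \<otimes> (inv \<gamma> \<otimes> \<alpha>)" using g S by (auto simp: m_assoc[symmetric])
    then have "inv \<gamma> \<otimes> \<alpha> \<notin> B" using r by blast
    then show "h (inv \<gamma> \<otimes> \<alpha>) * k \<alpha> = 0" by (simp add: supp)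
  qed
  finally show ?thesis ..
qed

lemma conv_assoc:
  assumes f: "f \<in> group_algebra G" and g: "g \<in> group_algebra G"
  shows "conv G (conv G f g) \<xi> = conv G f (conv G g \<xi>)"
proof
  fix \<alpha>
  show "conv G (conv G f g) \<xi> \<alpha> = conv G f (conv G g \<xi>) \<alpha>"
  proof (cases "\<alpha> \<in> carrier G")
    case a: True
    define A B where "A = {\<gamma>. f \<gamma> \<noteq> 0}" and "B = {\<delta>. g \<delta> \<noteq> 0}"
    \<comment> \<open>A finite set that contains the support of the product of \<open>f\<close> and \<open>g\<close>.\<close>
    define S where "S = (\<lambda>(\<gamma>, \<delta>). \<gamma> \<otimes> \<delta>) ` (A \<times> B)"
    have fin: "finite A" "finite B" "A \<subseteq> carrier G" "B \<subseteq> carrier G"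
      using f g by (auto simp: A_def B_def group_algebra_def)
    have S: "finite S" "S \<subseteq> carrier G" using fin by (auto simp: S_def)
    have supp: "{\<rho>. conv G f g \<rho> \<noteq> 0} \<subseteq> S"
    proof
      fix \<rho> assume "\<rho> \<in> {\<rho>. conv G f g \<rho> \<noteq> 0}"
      then have "conv G f g \<rho> \<noteq> 0" by simp
      from conv_support[OF f this] obtain \<gamma> \<beta> where "f \<gamma> \<noteq> 0" "g \<beta> \<noteq> 0" "\<rho> = \<gamma> \<otimes> \<beta>" by blast
      then show "\<rho> \<in> S" by (force simp: S_def A_def B_def)
    qed
    have inner: "(\<Sum>\<rho>\<in>S. g (inv \<gamma> \<otimes> \<rho>) * \<xi> (inv \<rho> \<otimes> \<alpha>))
        = (\<Sum>\<delta>\<in>B. g \<delta> * \<xi> (inv \<delta> \<otimes> (inv \<gamma> \<otimes> \<alpha>)))" if g: "\<gamma> \<in> A" for \<gamma>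
    proof -
      have gc: "\<gamma> \<in> carrier G" using g fin by auto
      have "(\<Sum>\<rho>\<in>S. g (inv \<gamma> \<otimes> \<rho>) * \<xi> (inv \<rho> \<otimes> \<alpha>)) = (\<Sum>\<delta>\<in>B. g \<delta> * \<xi> (inv (\<gamma> \<otimes> \<delta>) \<otimes> \<alpha>))"
        by (rule sum_translate[OF gc S fin(4)]) (use g in \<open>auto simp: S_def B_def\<close>)
      also have "\<dots> = (\<Sum>\<delta>\<in>B. g \<delta> * \<xi> (inv \<delta> \<otimes> (inv \<gamma> \<otimes> \<alpha>)))"
      proof (rule sum.cong)
        fix \<delta> assume "\<delta> \<in> B"
        then have "inv (\<gamma> \<otimes> \<delta>) \<otimes> \<alpha> = inv \<delta> \<otimes> (inv \<gamma> \<otimes> \<alpha>)"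
          using gc fin(4) a by (auto simp: inv_mult_group m_assoc)
        then show "g \<delta> * \<xi> (inv (\<gamma> \<otimes> \<delta>) \<otimes> \<alpha>) = g \<delta> * \<xi> (inv \<delta> \<otimes> (inv \<gamma> \<otimes> \<alpha>))" by simp
      qed simp
      finally show ?thesis .
    qed
    have "conv G (conv G f g) \<xi> \<alpha> = (\<Sum>\<rho>\<in>S. conv G f g \<rho> * \<xi> (inv \<rho> \<otimes> \<alpha>))"
      by (rule conv_eq_sum[OF S(1) supp a])
    also have "\<dots> = (\<Sum>\<rho>\<in>S. \<Sum>\<gamma>\<in>A. f \<gamma> * (g (inv \<gamma> \<otimes> \<rho>) * \<xi> (inv \<rho> \<otimes> \<alpha>)))"
      using S by (intro sum.cong) (auto simp: conv_def A_def sum_distrib_right mult.assoc)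
    also have "\<dots> = (\<Sum>\<gamma>\<in>A. f \<gamma> * (\<Sum>\<rho>\<in>S. g (inv \<gamma> \<otimes> \<rho>) * \<xi> (inv \<rho> \<otimes> \<alpha>)))"
      by (subst sum.swap) (simp add: sum_distrib_left)
    also have "\<dots> = (\<Sum>\<gamma>\<in>A. f \<gamma> * conv G g \<xi> (inv \<gamma> \<otimes> \<alpha>))"
    proof (rule sum.cong)
      fix \<gamma> assume g: "\<gamma> \<in> A"
      then have "inv \<gamma> \<otimes> \<alpha> \<in> carrier G" using fin a by auto
      then show "f \<gamma> * (\<Sum>\<rho>\<in>S. g (inv \<gamma> \<otimes> \<rho>) * \<xi> (inv \<rho> \<otimes> \<alpha>)) = f \<gamma> * conv G g \<xi> (inv \<gamma> \<otimes> \<alpha>)"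
        using inner[OF g] by (simp add: conv_def B_def)
    qed simp
    also have "\<dots> = conv G f (conv G g \<xi>) \<alpha>" using a by (simp add: conv_def A_def)
    finally show ?thesis .
  qed (simp add: conv_def)
qed

lemma unit_delta_in_group_algebra: "unit_delta G \<in> group_algebra G"
  by (rule group_algebraI[of "{\<one>}"]) (auto simp: unit_delta_def)

lemma conv_unit_left:
  assumes "\<And>x. x \<notin> carrier G \<Longrightarrow> \<xi> x = 0"
  shows "conv G (unit_delta G) \<xi> = \<xi>"
  using assms by (auto simp: fun_eq_iff unit_delta_def conv_def)

lemma conv_unit_right:
  assumes f: "f \<in> group_algebra G"
  shows "conv G f (unit_delta G) = f"
proof
  fix \<alpha>
  show "conv G f (unit_delta G) \<alpha> = f \<alpha>"
  proof (cases "\<alpha> \<in> carrier G")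
    case True
    have "conv G f (unit_delta G) \<alpha> = (\<Sum>\<gamma>\<in>insert \<alpha> {\<gamma>. f \<gamma> \<noteq> 0}. f \<gamma> * unit_delta G (inv \<gamma> \<otimes> \<alpha>))"
      using f True by (intro conv_eq_sum) (auto simp: group_algebra_def)
    also have "\<dots> = (\<Sum>\<gamma>\<in>insert \<alpha> {\<gamma>. f \<gamma> \<noteq> 0}. if \<gamma> = \<alpha> then f \<alpha> else 0)"
    proof (rule sum.cong)
      fix \<gamma> assume "\<gamma> \<in> insert \<alpha> {\<gamma>. f \<gamma> \<noteq> 0}"
      then have "\<gamma> \<in> carrier G" using True f by (auto simp: group_algebra_def)
      then have "inv \<gamma> \<otimes> \<alpha> = \<one> \<longleftrightarrow> \<gamma> = \<alpha>" using True
        by (metis inv_closed inv_equality inv_inv l_inv)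
      then show "f \<gamma> * unit_delta G (inv \<gamma> \<otimes> \<alpha>) = (if \<gamma> = \<alpha> then f \<alpha> else 0)"
        by (auto simp: unit_delta_def)
    qed simp
    also have "\<dots> = f \<alpha>" using f by (simp add: group_algebra_def)
    finally show ?thesis .
  next
    case False
    then show ?thesis using f by (auto simp: conv_def group_algebra_def)
  qed
qed

section \<open>Norms on the group algebra\<close>

text \<open>Translations preserve the norm, so the triangle inequality bounds the operator by the \<open>\<ell>\<^sup>1\<close> norm
  of \<open>f\<close>. This crude bound is what makes the operator norm of \<open>f\<close> well defined.\<close>

lemma ell_conv:
  assumes r: "1 \<le> r" and f: "f \<in> group_algebra G" and xi: "\<xi> \<in> ell r (carrier G)"
  shows "conv G f \<xi> \<in> ell r (carrier G)"
    and "ell_norm r (carrier G) (conv G f \<xi>) \<le> (\<Sum>\<gamma> | f \<gamma> \<noteq> 0. cmod (f \<gamma>)) * ell_norm r (carrier G) \<xi>"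
proof -
  define A where "A = {\<gamma>. f \<gamma> \<noteq> 0}"
  have A: "finite A" "A \<subseteq> carrier G" using f by (auto simp: A_def group_algebra_def)
  have bd: "fin_norm r F (conv G f \<xi>) \<le> (\<Sum>\<gamma>\<in>A. cmod (f \<gamma>)) * ell_norm r (carrier G) \<xi>"
    if F: "finite F" "F \<subseteq> carrier G" for F
  proof -
    have "fin_norm r F (\<lambda>\<alpha>. \<Sum>\<gamma>\<in>B. f \<gamma> * \<xi> (inv \<gamma> \<otimes> \<alpha>))
        \<le> (\<Sum>\<gamma>\<in>B. cmod (f \<gamma>)) * ell_norm r (carrier G) \<xi>" if "B \<subseteq> A" for B
      using finite_subset[OF that A(1)] that
    proof (induction B rule: finite_induct)
      case empty
      show ?case using fin_norm_scale[OF r F(1), of 0 \<xi>] by simp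
    next
      case (insert \<gamma> B)
      have g: "\<gamma> \<in> carrier G" using insert A by auto
      have "fin_norm r F (\<lambda>\<alpha>. \<xi> (inv \<gamma> \<otimes> \<alpha>)) = fin_norm r ((\<otimes>) (inv \<gamma>) ` F) \<xi>"
        using F g
        by (intro fin_norm_reindex inj_on_subset[OF left_translation_inj]) simp_all
      also have "\<dots> \<le> ell_norm r (carrier G) \<xi>"
        using F g by (intro fin_norm_le_ell_norm[OF r xi]) auto
      finally have 1: "fin_norm r F (\<lambda>\<alpha>. f \<gamma> * \<xi> (inv \<gamma> \<otimes> \<alpha>)) \<le> cmod (f \<gamma>) * ell_norm r (carrier G) \<xi>"
        by (simp add: fin_norm_scale[OF r F(1)] mult_left_mono)
      have "fin_norm r F (\<lambda>\<alpha>. \<Sum>\<gamma>\<in>insert \<gamma> B. f \<gamma> * \<xi> (inv \<gamma> \<otimes> \<alpha>))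
          = fin_norm r F (\<lambda>\<alpha>. f \<gamma> * \<xi> (inv \<gamma> \<otimes> \<alpha>) + (\<Sum>\<gamma>\<in>B. f \<gamma> * \<xi> (inv \<gamma> \<otimes> \<alpha>)))"
        using insert by simp
      also have "\<dots> \<le> cmod (f \<gamma>) * ell_norm r (carrier G) \<xi>
          + (\<Sum>\<gamma>\<in>B. cmod (f \<gamma>)) * ell_norm r (carrier G) \<xi>"
        using insert by (intro order_trans[OF fin_norm_triangle[OF r F(1)]] add_mono 1) auto
      also have "\<dots> = (\<Sum>\<gamma>\<in>insert \<gamma> B. cmod (f \<gamma>)) * ell_norm r (carrier G) \<xi>"
        using insert by (simp add: distrib_right)
      finally show ?case .
    qed
    moreover have "fin_norm r F (conv G f \<xi>) = fin_norm r F (\<lambda>\<alpha>. \<Sum>\<gamma>\<in>A. f \<gamma> * \<xi> (inv \<gamma> \<otimes> \<alpha>))"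
      using F by (intro fin_norm_cong) (auto simp: conv_def A_def)
    ultimately show ?thesis by simp
  qed
  show "conv G f \<xi> \<in> ell r (carrier G)"
    by (rule ell_boundedI(1)[OF r carrier_not_empty conv_outside bd])
  show "ell_norm r (carrier G) (conv G f \<xi>) \<le> (\<Sum>\<gamma> | f \<gamma> \<noteq> 0. cmod (f \<gamma>)) * ell_norm r (carrier G) \<xi>"
    unfolding A_def[symmetric] by (rule ell_norm_le[OF r carrier_not_empty bd])
qed

lemma group_algebra_imp_ell:
  assumes "1 \<le> r" "f \<in> group_algebra G" shows "f \<in> ell r (carrier G)"
  by (rule ell_norm_finite_support(1)[OF assms(1) carrier_not_empty, of "{x. f x \<noteq> 0}"])
    (use assms(2) in \<open>simp_all add: group_algebra_def\<close>)

lemma ell_norm_conv_le: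
  assumes r: "1 \<le> r" and f: "f \<in> group_algebra G" and xi: "\<xi> \<in> ell r (carrier G)"
  shows "ell_norm r (carrier G) (conv G f \<xi>) \<le> alg_norm G r f * ell_norm r (carrier G) \<xi>"
proof -
  have "ell_norm r (carrier G) (left_regular_alg G r f \<xi>) \<le> alg_norm G r f * ell_norm r (carrier G) \<xi>"
  proof (rule ell_norm_le_op_norm[OF r carrier_not_empty _ _ _ xi])
    fix \<xi> assume xi: "\<xi> \<in> ell r (carrier G)"
    show "left_regular_alg G r f \<xi> \<in> ell r (carrier G)"
      using ell_conv(1)[OF r f xi] left_regular_alg_eq_conv[OF f xi] by simp
    show "left_regular_alg G r f (\<lambda>x. c * \<xi> x) = (\<lambda>x. c * left_regular_alg G r f \<xi> x)" for c
      using left_regular_alg_eq_conv[OF f xi] conv_lincomb_right[of G f c \<xi> 0 \<xi>]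
        left_regular_alg_eq_conv[OF f ell_scale(1)[OF r carrier_not_empty xi], of c] by simp
    show "ell_norm r (carrier G) (left_regular_alg G r f \<xi>)
        \<le> (\<Sum>\<gamma> | f \<gamma> \<noteq> 0. cmod (f \<gamma>)) * ell_norm r (carrier G) \<xi>"
      using ell_conv(2)[OF r f xi] left_regular_alg_eq_conv[OF f xi] by simp
  qed
  then show ?thesis by (simp add: left_regular_alg_eq_conv[OF f xi])
qed

lemma ell_norm_unit_delta:
  assumes r: "1 \<le> r" shows "ell_norm r (carrier G) (unit_delta G) = 1"
  using ell_norm_finite_support(2)[OF r carrier_not_empty, of "{\<one>}" "unit_delta G"]
    fin_norm_singleton[OF r, of \<one> "unit_delta G"] by (simp add: unit_delta_def)

text \<open>Convolution with \<open>f\<close> sends the unit mass at \<open>\<one>\<close>, a vector of norm \<open>1\<close>, to \<open>f\<close>.\<close>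

lemma ell_norm_le_alg_norm:
  assumes r: "1 \<le> r" and f: "f \<in> group_algebra G"
  shows "ell_norm r (carrier G) f \<le> alg_norm G r f"
  using ell_norm_conv_le[OF r f group_algebra_imp_ell[OF r unit_delta_in_group_algebra]]
  by (simp add: conv_unit_right[OF f] ell_norm_unit_delta[OF r])

lemma alg_norm_nonneg:
  assumes "1 \<le> r" "f \<in> group_algebra G" shows "0 \<le> alg_norm G r f"
  by (rule order_trans[OF ell_norm_nonneg[OF assms(1) carrier_not_empty group_algebra_imp_ell[OF assms]]
        ell_norm_le_alg_norm[OF assms]])

lemma cmod_le_alg_norm:
  assumes "1 \<le> r" "f \<in> group_algebra G" shows "cmod (f x) \<le> alg_norm G r f"
  using cmod_le_ell_norm[OF assms(1) carrier_not_empty group_algebra_imp_ell[OF assms], of x]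
    ell_norm_le_alg_norm[OF assms] by linarith

lemma alg_norm_le:
  assumes r: "1 \<le> r" and f: "f \<in> group_algebra G" and "0 \<le> K"
    and bd: "\<And>\<xi>. \<xi> \<in> ell r (carrier G) \<Longrightarrow>
      ell_norm r (carrier G) (conv G f \<xi>) \<le> K * ell_norm r (carrier G) \<xi>"
  shows "alg_norm G r f \<le> K"
  using assms by (intro op_norm_le[OF r carrier_not_empty]) (simp_all add: left_regular_alg_eq_conv)

text \<open>Also for \<open>r = \<infinity>\<close>, where finitely supported vectors are not dense, they suffice to compute the norm:
  on a finite set, \<open>f\<xi>\<close> depends only on finitely many values of \<open>\<xi>\<close>.\<close>

lemma alg_norm_le_finite_support:
  assumes r: "1 \<le> r" and f: "f \<in> group_algebra G" and K: "0 \<le> K"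
    and bd: "\<And>\<xi>. \<xi> \<in> group_algebra G \<Longrightarrow>
      ell_norm r (carrier G) (conv G f \<xi>) \<le> K * ell_norm r (carrier G) \<xi>"
  shows "alg_norm G r f \<le> K"
proof (rule alg_norm_le[OF r f K])
  fix \<xi> assume xi: "\<xi> \<in> ell r (carrier G)"
  show "ell_norm r (carrier G) (conv G f \<xi>) \<le> K * ell_norm r (carrier G) \<xi>"
  proof (rule ell_norm_le[OF r carrier_not_empty])
    fix F assume F: "finite F" "F \<subseteq> carrier G"
    define A where "A = {\<gamma>. f \<gamma> \<noteq> 0}"
    have A: "finite A" "A \<subseteq> carrier G" using f by (auto simp: A_def group_algebra_def)
    define E where "E = (\<lambda>(\<gamma>, \<alpha>). inv \<gamma> \<otimes> \<alpha>) ` (A \<times> F)"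
    have E: "finite E" "E \<subseteq> carrier G" using A F by (auto simp: E_def)
    define \<zeta> where "\<zeta> = (\<lambda>x. if x \<in> E then \<xi> x else 0)"
    have z: "\<zeta> \<in> group_algebra G" using E by (intro group_algebraI[of E]) (auto simp: \<zeta>_def)
    have "fin_norm r F (conv G f \<xi>) = fin_norm r F (conv G f \<zeta>)"
      using F by (intro fin_norm_cong) (force simp: conv_def \<zeta>_def E_def A_def intro!: arg_cong[of _ _ cmod] sum.cong)
    also have "\<dots> \<le> ell_norm r (carrier G) (conv G f \<zeta>)"
      by (intro fin_norm_le_ell_norm r F carrier_not_empty ell_conv(1) f group_algebra_imp_ell z)
    also have "\<dots> \<le> K * ell_norm r (carrier G) \<zeta>" by (rule bd[OF z])
    also have "ell_norm r (carrier G) \<zeta> = fin_norm r E \<zeta>"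
      using E by (intro ell_norm_finite_support(2) r carrier_not_empty) (auto simp: \<zeta>_def)
    also have "\<dots> = fin_norm r E \<xi>" by (rule fin_norm_cong) (simp add: \<zeta>_def)
    also have "K * \<dots> \<le> K * ell_norm r (carrier G) \<xi>"
      by (intro mult_left_mono fin_norm_le_ell_norm r xi E carrier_not_empty K)
    finally show "fin_norm r F (conv G f \<xi>) \<le> K * ell_norm r (carrier G) \<xi>" by simp
  qed
qed

lemma alg_norm_conv:
  assumes r: "1 \<le> r" and f: "f \<in> group_algebra G" and g: "g \<in> group_algebra G"
  shows "alg_norm G r (conv G f g) \<le> alg_norm G r f * alg_norm G r g"
proof (rule alg_norm_le[OF r group_algebra_conv[OF f g]])
  show "0 \<le> alg_norm G r f * alg_norm G r g" using alg_norm_nonneg[OF r] f g by simp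
  fix \<xi> assume xi: "\<xi> \<in> ell r (carrier G)"
  have "ell_norm r (carrier G) (conv G f (conv G g \<xi>))
      \<le> alg_norm G r f * ell_norm r (carrier G) (conv G g \<xi>)"
    by (rule ell_norm_conv_le[OF r f ell_conv(1)[OF r g xi]])
  also have "\<dots> \<le> alg_norm G r f * (alg_norm G r g * ell_norm r (carrier G) \<xi>)"
    by (intro mult_left_mono ell_norm_conv_le r g xi alg_norm_nonneg f)
  finally show "ell_norm r (carrier G) (conv G (conv G f g) \<xi>)
      \<le> alg_norm G r f * alg_norm G r g * ell_norm r (carrier G) \<xi>"
    by (simp add: conv_assoc[OF f g] mult.assoc)
qed

lemma alg_norm_lincomb:
  assumes r: "1 \<le> r" and f: "f \<in> group_algebra G" and g: "g \<in> group_algebra G"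
  shows "alg_norm G r (\<lambda>x. a * f x + b * g x) \<le> cmod a * alg_norm G r f + cmod b * alg_norm G r g"
proof (rule alg_norm_le[OF r group_algebra_lincomb[OF f g]])
  show "0 \<le> cmod a * alg_norm G r f + cmod b * alg_norm G r g"
    using alg_norm_nonneg[OF r] f g by simp
  fix \<xi> assume xi: "\<xi> \<in> ell r (carrier G)"
  note cf = ell_conv(1)[OF r f xi] and cg = ell_conv(1)[OF r g xi]
  note I = carrier_not_empty
  have "ell_norm r (carrier G) (conv G (\<lambda>x. a * f x + b * g x) \<xi>)
      \<le> cmod a * ell_norm r (carrier G) (conv G f \<xi>) + cmod b * ell_norm r (carrier G) (conv G g \<xi>)"
    unfolding conv_lincomb_left[OF f g]
    using ell_add(2)[OF r I ell_scale(1)[OF r I cf, of a] ell_scale(1)[OF r I cg, of b]]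
      ell_scale(2)[OF r I cf, of a] ell_scale(2)[OF r I cg, of b] by linarith
  also have "\<dots> \<le> cmod a * (alg_norm G r f * ell_norm r (carrier G) \<xi>)
      + cmod b * (alg_norm G r g * ell_norm r (carrier G) \<xi>)"
    by (intro add_mono mult_left_mono ell_norm_conv_le r f g xi) auto
  finally show "ell_norm r (carrier G) (conv G (\<lambda>x. a * f x + b * g x) \<xi>)
      \<le> (cmod a * alg_norm G r f + cmod b * alg_norm G r g) * ell_norm r (carrier G) \<xi>"
    by (simp add: algebra_simps)
qed

text \<open>Summing over the support of \<open>\<xi>\<close> instead of that of \<open>h\<close> shows that the value at \<open>\<alpha>\<close> depends on
  finitely many values of \<open>h\<close>, at points independent of \<open>h\<close>.\<close>

lemma conv_eq_sum_right:
  assumes h: "h \<in> group_algebra G" and xi: "\<xi> \<in> group_algebra G" and a: "\<alpha> \<in> carrier G"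
  shows "conv G h \<xi> \<alpha> = (\<Sum>\<beta> | \<xi> \<beta> \<noteq> 0. h (\<alpha> \<otimes> inv \<beta>) * \<xi> \<beta>)"
proof -
  define B where "B = {\<beta>. \<xi> \<beta> \<noteq> 0}"
  have B: "finite B" "B \<subseteq> carrier G" using xi by (auto simp: B_def group_algebra_def)
  define A where "A = {\<gamma>. h \<gamma> \<noteq> 0}"
  have A: "finite A" "A \<subseteq> carrier G" using h by (auto simp: A_def group_algebra_def)
  have "(\<Sum>\<beta>\<in>B. h (\<alpha> \<otimes> inv \<beta>) * \<xi> \<beta>) = (\<Sum>\<gamma>\<in>(\<lambda>\<beta>. \<alpha> \<otimes> inv \<beta>) ` B. h \<gamma> * \<xi> (inv \<gamma> \<otimes> \<alpha>))"
  proof (subst sum.reindex)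
    show "inj_on (\<lambda>\<beta>. \<alpha> \<otimes> inv \<beta>) B"
    proof (rule inj_onI)
      fix x y assume "x \<in> B" "y \<in> B" "\<alpha> \<otimes> inv x = \<alpha> \<otimes> inv y"
      then show "x = y" 
        using B inj_onD[OF left_translation_inj[OF a]] by (metis inv_closed inv_inv subsetD)
    qed
    show "(\<Sum>\<beta>\<in>B. h (\<alpha> \<otimes> inv \<beta>) * \<xi> \<beta>)
        = sum ((\<lambda>\<gamma>. h \<gamma> * \<xi> (inv \<gamma> \<otimes> \<alpha>)) \<circ> (\<lambda>\<beta>. \<alpha> \<otimes> inv \<beta>)) B"
    proof (rule sum.cong)
      fix \<beta> assume "\<beta> \<in> B"
      then have "inv (\<alpha> \<otimes> inv \<beta>) \<otimes> \<alpha> = \<beta>" using B a by (auto simp: inv_mult_group m_assoc)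
      then show "h (\<alpha> \<otimes> inv \<beta>) * \<xi> \<beta> = ((\<lambda>\<gamma>. h \<gamma> * \<xi> (inv \<gamma> \<otimes> \<alpha>)) \<circ> (\<lambda>\<beta>. \<alpha> \<otimes> inv \<beta>)) \<beta>"
        by simp
    qed simp
  qed
  also have "\<dots> = (\<Sum>\<gamma>\<in>A \<union> (\<lambda>\<beta>. \<alpha> \<otimes> inv \<beta>) ` B. h \<gamma> * \<xi> (inv \<gamma> \<otimes> \<alpha>))"
  proof (rule sum.mono_neutral_left)
    show "\<forall>\<gamma>\<in>(A \<union> (\<lambda>\<beta>. \<alpha> \<otimes> inv \<beta>) ` B) - (\<lambda>\<beta>. \<alpha> \<otimes> inv \<beta>) ` B. h \<gamma> * \<xi> (inv \<gamma> \<otimes> \<alpha>) = 0"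
    proof
      fix \<gamma> assume g: "\<gamma> \<in> (A \<union> (\<lambda>\<beta>. \<alpha> \<otimes> inv \<beta>) ` B) - (\<lambda>\<beta>. \<alpha> \<otimes> inv \<beta>) ` B"
      then have gc: "\<gamma> \<in> carrier G" using A by auto
      have "\<gamma> = \<alpha> \<otimes> inv (inv \<gamma> \<otimes> \<alpha>)" using gc a by (simp add: inv_mult_group m_assoc[symmetric])
      then have "inv \<gamma> \<otimes> \<alpha> \<notin> B" using g by blast
      then show "h \<gamma> * \<xi> (inv \<gamma> \<otimes> \<alpha>) = 0" by (simp add: B_def)
    qed
  qed (use A B in auto)
  also have "\<dots> = conv G h \<xi> \<alpha>"
    using A B a by (intro conv_eq_sum[symmetric]) (auto simp: A_def)
  finally show ?thesis by (simp add: B_def)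
qed

text \<open>Lower semicontinuity for pointwise convergence. Against a finitely supported vector, pointwise convergence of \<open>f n\<close> gives pointwise convergence of
  the convolutions, to which Fatou's lemma applies.\<close>

lemma alg_norm_limit_le:
  assumes r: "1 \<le> r" and g: "g \<in> group_algebra G" and f: "\<And>n. f n \<in> group_algebra G"
    and le: "\<And>n. alg_norm G r (f n) \<le> K" and lim: "\<And>x. (\<lambda>n. f n x) \<longlonglongrightarrow> g x"
  shows "alg_norm G r g \<le> K"
proof (rule alg_norm_le_finite_support[OF r g])
  show "0 \<le> K" using le[of 0] alg_norm_nonneg[OF r f, of 0] by linarith
  fix \<xi> assume xi: "\<xi> \<in> group_algebra G"
  show "ell_norm r (carrier G) (conv G g \<xi>) \<le> K * ell_norm r (carrier G) \<xi>"
  proof (rule ell_norm_limit_le(2)[OF r carrier_not_empty conv_outside _ _ tendsto_const])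
    fix n
    show "conv G (f n) \<xi> \<in> ell r (carrier G)" by (intro ell_conv r f group_algebra_imp_ell xi)
    have "ell_norm r (carrier G) (conv G (f n) \<xi>) \<le> alg_norm G r (f n) * ell_norm r (carrier G) \<xi>"
      by (intro ell_norm_conv_le r f group_algebra_imp_ell xi)
    also have "\<dots> \<le> K * ell_norm r (carrier G) \<xi>"
      by (intro mult_right_mono le ell_norm_nonneg r carrier_not_empty group_algebra_imp_ell xi)
    finally show "ell_norm r (carrier G) (conv G (f n) \<xi>) \<le> K * ell_norm r (carrier G) \<xi>" .
  next
    fix \<alpha> assume a: "\<alpha> \<in> carrier G"
    show "(\<lambda>n. conv G (f n) \<xi> \<alpha>) \<longlonglongrightarrow> conv G g \<xi> \<alpha>"
      unfolding conv_eq_sum_right[OF f xi a] conv_eq_sum_right[OF g xi a]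
      by (intro tendsto_sum tendsto_mult lim tendsto_const)
  qed
qed

end

section \<open>Conjugate exponents\<close>

lemma conjugate_exponent_ge_1:
  assumes "1 / p + 1 / q = (1 :: ennreal)" shows "1 \<le> q"
proof (cases "q = \<infinity>")
  case False
  then obtain s where s: "q = ennreal s" "s \<ge> 0" by (cases q) auto
  have le: "1 / q \<le> 1" using assms le_iff_add[of "1 / q" 1] by (metis add.commute)
  then have "q \<noteq> 0" by (auto simp: top_unique)
  then have "0 < s" using s by (simp add: order_less_le)
  then show ?thesis using le s by (simp add: divide_ennreal flip: ennreal_1)
qed simp

lemma conjugate_exponents_real:
  assumes "1 \<le> p" "1 \<le> q" "1 / p + 1 / q = (1 :: ennreal)" "p \<noteq> \<infinity>" "q \<noteq> \<infinity>"
  shows "1 / enn2real p + 1 / enn2real q = 1"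
proof -
  obtain t where t: "p = ennreal t" "t \<ge> 0" using assms(4) by (cases p) auto
  obtain s where s: "q = ennreal s" "s \<ge> 0" using assms(5) by (cases q) auto
  have ts: "t \<ge> 1" "s \<ge> 1" using assms(1,2) t s by (auto simp: ennreal_ge_1)
  have "ennreal (1 / t + 1 / s) = ennreal 1"
    using assms(3) t s ts by (simp add: divide_ennreal flip: ennreal_1 ennreal_plus)
  then have "1 / t + 1 / s = 1" using ts by (subst (asm) ennreal_inj) auto
  then show ?thesis using t s by simp
qed

lemma conjugate_exponent_infinity:
  assumes "1 \<le> q" "1 / \<infinity> + 1 / q = (1 :: ennreal)"
  shows "q = 1"
proof -
  have 1: "1 / q = 1" using assms(2) by simp
  then have "q \<noteq> \<infinity>" by auto
  then obtain s where s: "q = ennreal s" "s \<ge> 0" by (cases q) auto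
  have "s \<ge> 1" using assms(1) s by (auto simp: ennreal_ge_1)
  then have "ennreal (1 / s) = ennreal 1" using 1 s by (simp add: divide_ennreal flip: ennreal_1)
  then have "1 / s = 1" using \<open>s \<ge> 1\<close> by (subst (asm) ennreal_inj) auto
  then show ?thesis using s by (simp add: field_simps split: if_splits)
qed

section \<open>Symmetric operators and rapid decay\<close>

text \<open>Otherwise \<open>(x/y)\<^sup>n\<close> would be bounded along the powers of \<open>2\<close>.\<close>

lemma le_if_power_two_power_le:
  fixes x y s C :: real
  assumes "0 \<le> x" "0 \<le> y" "0 < s" and le: "\<And>k. x ^ (2 ^ k) * s \<le> C * y ^ (2 ^ k)"
  shows "x \<le> y"
proof (rule ccontr)
  assume "\<not> x \<le> y"
  then have xy: "y < x" by simp
  show False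
  proof (cases "y = 0")
    case True
    then show False using le[of 0] xy assms by (simp add: mult_le_0_iff)
  next
    case False
    then have y: "0 < y" using assms by simp
    then have gt: "1 < x / y" using xy by simp
    then obtain n where n: "C / s < (x / y) ^ n" using real_arch_pow by blast
    have "(x / y) ^ n \<le> (x / y) ^ (2 ^ n)"
      using gt by (intro power_increasing) (auto simp: less_imp_le)
    also have "\<dots> \<le> C / s" using le[of n] y assms(3) by (simp add: power_divide field_simps)
    finally show False using n by simp
  qed
qed

text \<open>The inner product of \<open>\<ell>\<^sup>2\<close>, as a sum over the common support: it is a genuine finite sum as soon as
  one of the two arguments is finitely supported.\<close>

definition inner_sum :: "('a \<Rightarrow> complex) \<Rightarrow> ('a \<Rightarrow> complex) \<Rightarrow> complex" where
  "inner_sum \<xi> \<eta> = (\<Sum>x | \<xi> x \<noteq> 0 \<and> \<eta> x \<noteq> 0. \<xi> x * cnj (\<eta> x))"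

lemma inner_sum_eq:
  "finite S \<Longrightarrow> {x. \<xi> x \<noteq> 0 \<and> \<eta> x \<noteq> 0} \<subseteq> S \<Longrightarrow> inner_sum \<xi> \<eta> = (\<Sum>x\<in>S. \<xi> x * cnj (\<eta> x))"
  unfolding inner_sum_def by (rule sum.mono_neutral_left) auto

definition star :: "('a, 'm) monoid_scheme \<Rightarrow> ('a \<Rightarrow> complex) \<Rightarrow> 'a \<Rightarrow> complex" where
  "star G f = (\<lambda>\<alpha>. if \<alpha> \<in> carrier G then cnj (f (inv\<^bsub>G\<^esub> \<alpha>)) else 0)"

lemma fin_norm_2: "fin_norm 2 F \<xi> = L2_set (\<lambda>x. cmod (\<xi> x)) F"
  by (simp add: fin_norm_def L2_set_def powr_half_sqrt sum_nonneg)

context group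
begin

lemma star_support: "f \<in> group_algebra G \<Longrightarrow> {\<gamma>. star G f \<gamma> \<noteq> 0} = (\<lambda>\<gamma>. inv \<gamma>) ` {\<gamma>. f \<gamma> \<noteq> 0}"
  by (force simp: star_def group_algebra_def image_iff)

lemma group_algebra_star:
  assumes "f \<in> group_algebra G" shows "star G f \<in> group_algebra G"
  unfolding group_algebra_def mem_Collect_eq star_support[OF assms]
  using assms by (auto simp: group_algebra_def)

lemma inv_inj_on: "S \<subseteq> carrier G \<Longrightarrow> inj_on (\<lambda>\<gamma>. inv \<gamma>) S"
  by (metis inj_on_inverseI inv_inv subsetD)

lemma ell_norm_star:
  assumes r: "1 \<le> r" and f: "f \<in> group_algebra G"
  shows "ell_norm r (carrier G) (star G f) = ell_norm r (carrier G) f"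
proof -
  define A where "A = {\<gamma>. f \<gamma> \<noteq> 0}"
  have A: "finite A" "A \<subseteq> carrier G" using f by (auto simp: A_def group_algebra_def)
  have "ell_norm r (carrier G) (star G f) = fin_norm r ((\<lambda>\<gamma>. inv \<gamma>) ` A) (star G f)"
    using A star_support[OF f] by (intro ell_norm_finite_support(2) r carrier_not_empty) (auto simp: A_def)
  also have "\<dots> = fin_norm r A (\<lambda>\<gamma>. star G f (inv \<gamma>))"
    by (rule fin_norm_reindex[OF inv_inj_on[OF A(2)], symmetric])
  also have "\<dots> = fin_norm r A f"
    using A by (intro fin_norm_cong) (auto simp: star_def)
  also have "\<dots> = ell_norm r (carrier G) f"
    using A by (intro ell_norm_finite_support(2)[symmetric] r carrier_not_empty) (auto simp: A_def)
  finally show ?thesis .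
qed

lemma inner_sum_conv:
  assumes f: "f \<in> group_algebra G" and xi: "\<xi> \<in> group_algebra G"
  shows "inner_sum (conv G f \<xi>) \<eta> = inner_sum \<xi> (conv G (star G f) \<eta>)"
proof -
  define A B where "A = {\<gamma>. f \<gamma> \<noteq> 0}" and "B = {x. \<xi> x \<noteq> 0}"
  define S where "S = (\<lambda>(\<gamma>, \<delta>). \<gamma> \<otimes> \<delta>) ` (A \<times> B)"
  have fin: "finite A" "finite B" "A \<subseteq> carrier G" "B \<subseteq> carrier G"
    using f xi by (auto simp: A_def B_def group_algebra_def)
  have S: "finite S" "S \<subseteq> carrier G" using fin by (auto simp: S_def)
  have supp: "conv G f \<xi> \<alpha> = 0" if "\<alpha> \<notin> S" for \<alpha>
  proof (rule ccontr)
    assume "conv G f \<xi> \<alpha> \<noteq> 0"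
    from conv_support[OF f this] obtain \<gamma> \<beta> where "f \<gamma> \<noteq> 0" "\<xi> \<beta> \<noteq> 0" "\<alpha> = \<gamma> \<otimes> \<beta>" by blast
    then show False using that by (force simp: S_def A_def B_def)
  qed
  have "inner_sum (conv G f \<xi>) \<eta> = (\<Sum>\<alpha>\<in>S. conv G f \<xi> \<alpha> * cnj (\<eta> \<alpha>))"
    using S supp by (intro inner_sum_eq) auto
  also have "\<dots> = (\<Sum>\<alpha>\<in>S. \<Sum>\<gamma>\<in>A. f \<gamma> * (\<xi> (inv \<gamma> \<otimes> \<alpha>) * cnj (\<eta> \<alpha>)))"
    using S by (intro sum.cong) (auto simp: conv_def A_def sum_distrib_right mult.assoc)
  also have "\<dots> = (\<Sum>\<gamma>\<in>A. f \<gamma> * (\<Sum>\<alpha>\<in>S. \<xi> (inv \<gamma> \<otimes> \<alpha>) * cnj (\<eta> \<alpha>)))"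
    by (subst sum.swap) (simp add: sum_distrib_left)
  also have "\<dots> = (\<Sum>\<gamma>\<in>A. f \<gamma> * (\<Sum>\<beta>\<in>B. \<xi> \<beta> * cnj (\<eta> (\<gamma> \<otimes> \<beta>))))"
  proof (rule sum.cong)
    fix \<gamma> assume g: "\<gamma> \<in> A"
    have "(\<Sum>\<alpha>\<in>S. \<xi> (inv \<gamma> \<otimes> \<alpha>) * cnj (\<eta> \<alpha>)) = (\<Sum>\<beta>\<in>B. \<xi> \<beta> * cnj (\<eta> (\<gamma> \<otimes> \<beta>)))"
      by (rule sum_translate[OF _ S fin(4)]) (use g fin in \<open>auto simp: S_def B_def\<close>)
    then show "f \<gamma> * (\<Sum>\<alpha>\<in>S. \<xi> (inv \<gamma> \<otimes> \<alpha>) * cnj (\<eta> \<alpha>))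
        = f \<gamma> * (\<Sum>\<beta>\<in>B. \<xi> \<beta> * cnj (\<eta> (\<gamma> \<otimes> \<beta>)))" by simp
  qed simp
  also have "\<dots> = (\<Sum>\<beta>\<in>B. \<xi> \<beta> * cnj (\<Sum>\<gamma>\<in>A. cnj (f \<gamma>) * \<eta> (\<gamma> \<otimes> \<beta>)))"
    by (simp add: sum_distrib_left, subst sum.swap, simp add: algebra_simps)
  also have "\<dots> = (\<Sum>\<beta>\<in>B. \<xi> \<beta> * cnj (conv G (star G f) \<eta> \<beta>))"
  proof (rule sum.cong)
    fix \<beta> assume b: "\<beta> \<in> B"
    have "conv G (star G f) \<eta> \<beta> = (\<Sum>\<gamma>\<in>(\<lambda>\<gamma>. inv \<gamma>) ` A. star G f \<gamma> * \<eta> (inv \<gamma> \<otimes> \<beta>))"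
      using b fin star_support[OF f] by (intro conv_eq_sum) (auto simp: A_def)
    also have "\<dots> = (\<Sum>\<gamma>\<in>A. star G f (inv \<gamma>) * \<eta> (inv (inv \<gamma>) \<otimes> \<beta>))"
      by (simp add: sum.reindex[OF inv_inj_on[OF fin(3)]])
    also have "\<dots> = (\<Sum>\<gamma>\<in>A. cnj (f \<gamma>) * \<eta> (\<gamma> \<otimes> \<beta>))"
      using fin by (intro sum.cong) (auto simp: star_def)
    finally show "\<xi> \<beta> * cnj (\<Sum>\<gamma>\<in>A. cnj (f \<gamma>) * \<eta> (\<gamma> \<otimes> \<beta>)) = \<xi> \<beta> * cnj (conv G (star G f) \<eta> \<beta>)" by simp
  qed simp
  also have "\<dots> = inner_sum \<xi> (conv G (star G f) \<eta>)"
    using fin by (intro inner_sum_eq[symmetric]) (auto simp: B_def)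
  finally show ?thesis .
qed

lemma ell_norm_2_eq_L2_set:
  assumes "f \<in> group_algebra G" "finite S" "S \<subseteq> carrier G" "{x. f x \<noteq> 0} \<subseteq> S"
  shows "ell_norm 2 (carrier G) f = L2_set (\<lambda>x. cmod (f x)) S"
  using ell_norm_finite_support(2)[OF _ carrier_not_empty, of 2 S f] assms by (auto simp: fin_norm_2)

lemma inner_sum_self:
  assumes f: "f \<in> group_algebra G"
  shows "inner_sum f f = complex_of_real ((ell_norm 2 (carrier G) f)\<^sup>2)"
proof -
  have "ell_norm 2 (carrier G) f = L2_set (\<lambda>x. cmod (f x)) {x. f x \<noteq> 0}"
    using f by (intro ell_norm_2_eq_L2_set) (auto simp: group_algebra_def)
  then have "(ell_norm 2 (carrier G) f)\<^sup>2 = (\<Sum>x | f x \<noteq> 0. (cmod (f x))\<^sup>2)"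
    by (simp add: L2_set_def sum_nonneg)
  then show ?thesis by (simp add: inner_sum_def complex_norm_square flip: of_real_power)
qed

lemma cmod_inner_sum_le:
  assumes f: "f \<in> group_algebra G" and g: "g \<in> group_algebra G"
  shows "cmod (inner_sum f g) \<le> ell_norm 2 (carrier G) f * ell_norm 2 (carrier G) g"
proof -
  define S where "S = {x. f x \<noteq> 0} \<union> {x. g x \<noteq> 0}"
  have S: "finite S" "S \<subseteq> carrier G" using f g by (auto simp: S_def group_algebra_def)
  have "inner_sum f g = (\<Sum>x\<in>S. f x * cnj (g x))"
    using S by (intro inner_sum_eq) (auto simp: S_def)
  then have "cmod (inner_sum f g) \<le> (\<Sum>x\<in>S. \<bar>cmod (f x)\<bar> * \<bar>cmod (g x)\<bar>)"
    by (simp add: norm_mult sum_norm_le)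
  also have "\<dots> \<le> L2_set (\<lambda>x. cmod (f x)) S * L2_set (\<lambda>x. cmod (g x)) S"
    by (rule L2_set_mult_ineq)
  also have "\<dots> = ell_norm 2 (carrier G) f * ell_norm 2 (carrier G) g"
    using ell_norm_2_eq_L2_set[OF f S] ell_norm_2_eq_L2_set[OF g S] by (simp add: S_def)
  finally show ?thesis .
qed

text \<open>A spectral radius argument that passes from \<open>\<ell>\<^sup>q\<close> to \<open>\<ell>\<^sup>2\<close>. By the Cauchy-Schwarz inequality, \<open>\<bar>\<langle>A\<xi>, \<xi>\<rangle>\<bar>\<^sup>2 \<le> \<langle>A\<^sup>2\<xi>, \<xi>\<rangle> \<parallel>\<xi>\<parallel>\<^sup>2\<close>; iterating this \<open>k\<close> times bounds the \<open>2\<^sup>k\<close>-th power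
  of \<open>\<bar>\<langle>A\<xi>, \<xi>\<rangle>\<bar>\<close> by \<open>\<bar>\<langle>A\<^sup>m\<xi>, \<xi>\<rangle>\<bar>\<close> with \<open>m = 2\<^sup>k\<close>, up to the power of \<open>\<parallel>\<xi>\<parallel>\<close> required by homogeneity. The latter is at most a constant multiple of \<open>M\<^sup>m\<close>,
  and the constant, which depends on the finitely supported \<open>\<xi>\<close>, disappears in the limit.\<close>

lemma symmetric_operator_bound:
  assumes q: "1 \<le> q" and M: "0 \<le> M" and xi: "\<xi> \<in> group_algebra G"
    and A: "\<And>\<eta>. \<eta> \<in> group_algebra G \<Longrightarrow> A \<eta> \<in> group_algebra G"
    and sym: "\<And>\<eta> \<zeta>. \<eta> \<in> group_algebra G \<Longrightarrow> \<zeta> \<in> group_algebra G \<Longrightarrow>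
        inner_sum (A \<eta>) \<zeta> = inner_sum \<eta> (A \<zeta>)"
    and bd: "\<And>\<eta>. \<eta> \<in> group_algebra G \<Longrightarrow>
        ell_norm q (carrier G) (A \<eta>) \<le> M * ell_norm q (carrier G) \<eta>"
  shows "cmod (inner_sum (A \<xi>) \<xi>) \<le> M * (ell_norm 2 (carrier G) \<xi>)\<^sup>2"
proof (cases "ell_norm 2 (carrier G) \<xi> = 0")
  case True
  then show ?thesis using cmod_inner_sum_le[OF A[OF xi] xi] by simp
next
  case False
  define s where "s = (ell_norm 2 (carrier G) \<xi>)\<^sup>2"
  have s: "0 < s" using False by (simp add: s_def)
  \<comment> \<open>The pairing of \<open>A\<xi>\<close> with \<open>\<xi>\<close> is estimated by the sup norm of \<open>A\<xi>\<close>, hence by its \<open>\<ell>\<^sup>q\<close> norm, times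
    the \<open>\<ell>\<^sup>1\<close> norm of \<open>\<xi>\<close>.\<close>
  define C where "C = ell_norm q (carrier G) \<xi> * (\<Sum>x | \<xi> x \<noteq> 0. cmod (\<xi> x))"
  have C: "0 \<le> C" unfolding C_def
    by (intro mult_nonneg_nonneg ell_norm_nonneg q carrier_not_empty group_algebra_imp_ell xi sum_nonneg) simp
  have "cmod (inner_sum (A \<xi>) \<xi>) ^ (2 ^ k) * s \<le> C * (M * s) ^ (2 ^ k)" for k
    using A sym bd M
  proof (induction k arbitrary: A M)
    case 0
    have "inner_sum (A \<xi>) \<xi> = (\<Sum>x | \<xi> x \<noteq> 0. A \<xi> x * cnj (\<xi> x))"
      using xi by (intro inner_sum_eq) (auto simp: group_algebra_def)
    then have "cmod (inner_sum (A \<xi>) \<xi>) \<le> (\<Sum>x | \<xi> x \<noteq> 0. cmod (A \<xi> x) * cmod (\<xi> x))"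
      by (simp add: norm_mult sum_norm_le)
    also have "\<dots> \<le> (\<Sum>x | \<xi> x \<noteq> 0. (M * ell_norm q (carrier G) \<xi>) * cmod (\<xi> x))"
    proof (intro sum_mono mult_right_mono)
      fix x
      show "cmod (A \<xi> x) \<le> M * ell_norm q (carrier G) \<xi>"
        by (rule order_trans[OF cmod_le_ell_norm[OF q carrier_not_empty
                group_algebra_imp_ell[OF q 0(1)[OF xi]]] 0(3)[OF xi]])
    qed simp
    also have "\<dots> = C * M" by (simp add: C_def sum_distrib_left mult_ac)
    finally show ?case using s by (simp add: mult_right_mono)
  next
    case (Suc k)
    let ?x = "cmod (inner_sum (A \<xi>) \<xi>)" and ?y = "cmod (inner_sum (A (A \<xi>)) \<xi>)"
    have "?x \<le> ell_norm 2 (carrier G) (A \<xi>) * ell_norm 2 (carrier G) \<xi>"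
      by (rule cmod_inner_sum_le[OF Suc.prems(1)[OF xi] xi])
    then have "?x\<^sup>2 \<le> (ell_norm 2 (carrier G) (A \<xi>))\<^sup>2 * s"
      unfolding s_def power_mult_distrib[symmetric] by (rule power_mono) simp
    also have "(ell_norm 2 (carrier G) (A \<xi>))\<^sup>2 = cmod (inner_sum (A \<xi>) (A \<xi>))"
      by (simp add: inner_sum_self[OF Suc.prems(1)[OF xi]] norm_power)
    also have "inner_sum (A \<xi>) (A \<xi>) = inner_sum (A (A \<xi>)) \<xi>"
      by (rule Suc.prems(2)[OF Suc.prems(1)[OF xi] xi, symmetric])
    finally have "(?x\<^sup>2) ^ (2 ^ k) * s \<le> (?y * s) ^ (2 ^ k) * s"
      using s by (intro mult_right_mono power_mono) auto
    also have "\<dots> = (?y ^ (2 ^ k) * s) * s ^ (2 ^ k)"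
      by (simp add: power_mult_distrib)
    also have "?y ^ (2 ^ k) * s \<le> C * ((M * M) * s) ^ (2 ^ k)"
    proof (rule Suc.IH)
      fix \<eta> \<zeta> assume e: "\<eta> \<in> group_algebra G"
      show "A (A \<eta>) \<in> group_algebra G" by (intro Suc.prems e)
      have "ell_norm q (carrier G) (A (A \<eta>)) \<le> M * ell_norm q (carrier G) (A \<eta>)"
        by (intro Suc.prems e)
      also have "\<dots> \<le> M * (M * ell_norm q (carrier G) \<eta>)" by (intro mult_left_mono Suc.prems e)
      finally show "ell_norm q (carrier G) (A (A \<eta>)) \<le> M * M * ell_norm q (carrier G) \<eta>"
        by (simp add: mult.assoc)
      assume z: "\<zeta> \<in> group_algebra G"
      show "inner_sum (A (A \<eta>)) \<zeta> = inner_sum \<eta> (A (A \<zeta>))"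
        using Suc.prems(2)[OF Suc.prems(1)[OF e] z] Suc.prems(2)[OF e Suc.prems(1)[OF z]] by simp
    qed (use Suc.prems in simp)
    finally have "(?x\<^sup>2) ^ (2 ^ k) * s \<le> C * (M * M * s) ^ (2 ^ k) * s ^ (2 ^ k)"
      using s by (simp add: mult_right_mono)
    also have "\<dots> = C * ((M * s)\<^sup>2) ^ (2 ^ k)"
      by (simp add: power2_eq_square mult_ac flip: power_mult_distrib)
    finally show ?case by (simp add: power_mult)
  qed
  then have "cmod (inner_sum (A \<xi>) \<xi>) \<le> M * s"
    by (rule le_if_power_two_power_le[OF norm_ge_zero _ s, rotated]) (use s M in simp)
  then show ?thesis by (simp add: s_def)
qed

text \<open>This plays the role of interpolation between \<open>\<ell>\<^sup>q\<close> and its dual: apply the bound for symmetric operators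
  to \<open>f\<^sup>* f\<close>, whose quadratic form is \<open>\<parallel>f\<xi>\<parallel>\<^sup>2\<close>.\<close>

lemma alg_norm_2_le:
  assumes q: "1 \<le> q" and f: "f \<in> group_algebra G" and K: "0 \<le> K"
    and "alg_norm G q f \<le> K" "alg_norm G q (star G f) \<le> K"
  shows "alg_norm G 2 f \<le> K"
proof (rule alg_norm_le_finite_support[OF _ f K])
  show "1 \<le> (2 :: ennreal)" by simp
  fix \<xi> assume xi: "\<xi> \<in> group_algebra G"
  note sf = group_algebra_star[OF f] and fxi = group_algebra_conv[OF f xi]
  define A where "A = (\<lambda>\<eta>. conv G (star G f) (conv G f \<eta>))"
  have star2: "conv G (star G (star G f)) = conv G f"
  proof -
    have "star G (star G f) = f" using f by (auto simp: star_def fun_eq_iff group_algebra_def)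
    then show ?thesis by simp
  qed
  have "cmod (inner_sum (A \<xi>) \<xi>) \<le> (K * K) * (ell_norm 2 (carrier G) \<xi>)\<^sup>2"
  proof (rule symmetric_operator_bound[OF q _ xi])
    fix \<eta> \<zeta> assume e: "\<eta> \<in> group_algebra G"
    show "A \<eta> \<in> group_algebra G" unfolding A_def by (intro group_algebra_conv f sf e)
    have "ell_norm q (carrier G) (A \<eta>) \<le> alg_norm G q (star G f) * ell_norm q (carrier G) (conv G f \<eta>)"
      unfolding A_def by (intro ell_norm_conv_le q sf group_algebra_imp_ell group_algebra_conv f e)
    also have "\<dots> \<le> K * (alg_norm G q f * ell_norm q (carrier G) \<eta>)"
      using assms(5) by (intro mult_mono ell_norm_conv_le ell_norm_nonneg carrier_not_empty q
        group_algebra_imp_ell group_algebra_conv f e K)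
    also have "\<dots> \<le> K * (K * ell_norm q (carrier G) \<eta>)"
      using assms(4) by (intro mult_left_mono mult_right_mono ell_norm_nonneg carrier_not_empty q
        group_algebra_imp_ell e K)
    finally show "ell_norm q (carrier G) (A \<eta>) \<le> K * K * ell_norm q (carrier G) \<eta>"
      by (simp add: mult.assoc)
    assume z: "\<zeta> \<in> group_algebra G"
    show "inner_sum (A \<eta>) \<zeta> = inner_sum \<eta> (A \<zeta>)"
      unfolding A_def by (simp add: inner_sum_conv[OF sf group_algebra_conv[OF f e]] star2 inner_sum_conv[OF f e])
  qed (use K in simp)
  moreover have "inner_sum (A \<xi>) \<xi> = complex_of_real ((ell_norm 2 (carrier G) (conv G f \<xi>))\<^sup>2)"
    unfolding A_def by (simp add: inner_sum_conv[OF sf fxi] star2 inner_sum_self[OF fxi])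
  ultimately have "(ell_norm 2 (carrier G) (conv G f \<xi>))\<^sup>2 \<le> (K * ell_norm 2 (carrier G) \<xi>)\<^sup>2"
    by (simp add: power_mult_distrib power2_eq_square norm_mult mult_ac)
  moreover have "0 \<le> K * ell_norm 2 (carrier G) \<xi>"
    by (intro mult_nonneg_nonneg K ell_norm_nonneg carrier_not_empty group_algebra_imp_ell xi) simp_all
  ultimately show "ell_norm 2 (carrier G) (conv G f \<xi>) \<le> K * ell_norm 2 (carrier G) \<xi>"
    by (rule power2_le_imp_le)
qed

text \<open>The extremal case of Hoelder's inequality. For \<open>q = \<infinity>\<close> each value of \<open>f\<close> is bounded by the norm. For
  finite \<open>q\<close>, the value of \<open>f\<xi>\<close> at \<open>\<one>\<close> is the pairing of \<open>f\<close> with the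
  reflection of \<open>\<xi>\<close>; for the \<open>\<xi>\<close> that makes this pairing equal to \<open>\<parallel>f\<parallel>\<^sub>q\<^sup>q\<close>, the norm \<open>\<parallel>\<xi>\<parallel>\<^sub>p\<close> is at most
  \<open>\<parallel>f\<parallel>\<^sub>q\<close> to the power \<open>q - 1\<close>.\<close>

lemma ell_norm_le_conjugate_alg_norm:
  assumes p: "1 \<le> p" and q: "1 \<le> q" and pq: "1 / p + 1 / q = 1" and f: "f \<in> group_algebra G"
  shows "ell_norm q (carrier G) f \<le> alg_norm G p f"
proof (cases "q = \<infinity>")
  case True
  have "fin_norm q F f \<le> alg_norm G p f" if "finite F" for F
    unfolding fin_norm_infinity_le_iff[OF True that alg_norm_nonneg[OF p f]]
    using cmod_le_alg_norm[OF p f] by blast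
  then show ?thesis by (intro ell_norm_le q carrier_not_empty)
next
  case False
  define s where "s = enn2real q"
  have s: "1 \<le> s" using one_le_enn2real[OF q False] by (simp add: s_def)
  define A where "A = {\<gamma>. f \<gamma> \<noteq> 0}"
  have A: "finite A" "A \<subseteq> carrier G" using f by (auto simp: A_def group_algebra_def)
  define S where "S = (\<Sum>\<gamma>\<in>A. cmod (f \<gamma>) powr s)"
  have S: "0 \<le> S" by (simp add: S_def sum_nonneg)
  have norm_f: "ell_norm q (carrier G) f = S powr (1 / s)"
    using ell_norm_finite_support(2)[OF q carrier_not_empty A, of f] False
    by (simp add: fin_norm_def S_def s_def A_def)
  \<comment> \<open>The extremal vector; for \<open>s = 1\<close> it is the reflected conjugate sign of \<open>f\<close>.\<close>
  define \<xi> where "\<xi> = (\<lambda>\<beta>. if \<beta> \<in> carrier G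
    then cnj (sgn (f (inv \<beta>))) * complex_of_real (cmod (f (inv \<beta>)) powr (s - 1)) else 0)"
  have supp: "\<xi> \<beta> = 0" if "\<beta> \<notin> (\<lambda>\<gamma>. inv \<gamma>) ` A" for \<beta>
  proof (cases "\<beta> \<in> carrier G")
    case True
    then have "inv \<beta> \<notin> A" using that by (metis image_eqI inv_inv)
    then show ?thesis by (simp add: \<xi>_def A_def)
  qed (simp add: \<xi>_def)
  have invA: "finite ((\<lambda>\<gamma>. inv \<gamma>) ` A)" "(\<lambda>\<gamma>. inv \<gamma>) ` A \<subseteq> carrier G" using A by auto
  have xi: "\<xi> \<in> group_algebra G" by (rule group_algebraI[OF invA supp])
  have "ell_norm p (carrier G) \<xi> = fin_norm p ((\<lambda>\<gamma>. inv \<gamma>) ` A) \<xi>"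
    by (rule ell_norm_finite_support(2)[OF p carrier_not_empty invA supp])
  also have "\<dots> = fin_norm p A (\<lambda>\<gamma>. \<xi> (inv \<gamma>))"
    by (rule fin_norm_reindex[OF inv_inj_on[OF A(2)], symmetric])
  also have "\<dots> = fin_norm p A (\<lambda>\<gamma>. complex_of_real (cmod (f \<gamma>) powr (s - 1)))"
    using A by (intro fin_norm_cong) (auto simp: \<xi>_def norm_mult norm_sgn A_def)
  finally have norm_xi: "ell_norm p (carrier G) \<xi> = \<dots>" .
  have "conv G f \<xi> \<one> = (\<Sum>\<gamma>\<in>A. complex_of_real (cmod (f \<gamma>) powr s))"
    unfolding conv_def A_def[symmetric]
  proof (simp, rule sum.cong)
    fix \<gamma> assume g: "\<gamma> \<in> A"
    then have gc: "\<gamma> \<in> carrier G" "f \<gamma> \<noteq> 0" using A by (auto simp: A_def)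
    have "f \<gamma> * cnj (sgn (f \<gamma>)) = complex_of_real (cmod (f \<gamma>))"
      using gc(2) by (simp add: sgn_eq complex_norm_square[symmetric] power2_eq_square)
    then have "f \<gamma> * \<xi> (inv \<gamma> \<otimes> \<one>) = complex_of_real (cmod (f \<gamma>) * cmod (f \<gamma>) powr (s - 1))"
      using gc by (simp add: \<xi>_def mult.assoc[symmetric])
    also have "cmod (f \<gamma>) * cmod (f \<gamma>) powr (s - 1) = cmod (f \<gamma>) powr s"
      using gc by (simp add: powr_diff)
    finally show "f \<gamma> * \<xi> (inv \<gamma> \<otimes> \<one>) = complex_of_real (cmod (f \<gamma>) powr s)" .
  qed simp
  then have "conv G f \<xi> \<one> = complex_of_real S" by (simp add: S_def)
  then have "S = cmod (conv G f \<xi> \<one>)" using S by simp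
  also have "\<dots> \<le> ell_norm p (carrier G) (conv G f \<xi>)"
    by (intro cmod_le_ell_norm p carrier_not_empty ell_conv f group_algebra_imp_ell xi)
  also have "\<dots> \<le> alg_norm G p f * ell_norm p (carrier G) \<xi>"
    by (intro ell_norm_conv_le p f group_algebra_imp_ell xi)
  finally have key: "S \<le> alg_norm G p f * ell_norm p (carrier G) \<xi>" .
  show ?thesis
  proof (cases "p = \<infinity>")
    case True
    then have "q = 1" using conjugate_exponent_infinity[OF q] pq by simp
    then have s1: "s = 1" by (simp add: s_def)
    have "ell_norm p (carrier G) \<xi> \<le> 1"
      unfolding norm_xi by (subst fin_norm_infinity_le_iff[OF True A(1)]) (auto simp: s1 A_def)
    then have "alg_norm G p f * ell_norm p (carrier G) \<xi> \<le> alg_norm G p f * 1"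
      by (intro mult_left_mono alg_norm_nonneg p f)
    then show ?thesis using key S by (simp add: norm_f s1)
  next
    case pfin: False
    define t where "t = enn2real p"
    have t: "1 \<le> t" using one_le_enn2real[OF p pfin] by (simp add: t_def)
    have ts: "1 / t + 1 / s = 1" using conjugate_exponents_real[OF p q pq pfin False] by (simp add: t_def s_def)
    then have mul: "(s - 1) * t = s" using t s by (simp add: field_simps)
    have nx: "ell_norm p (carrier G) \<xi> = S powr (1 / t)"
      unfolding norm_xi using pfin by (simp add: fin_norm_def S_def powr_powr mul flip: t_def)
    show ?thesis
    proof (cases "S = 0")
      case True
      then show ?thesis using norm_f alg_norm_nonneg[OF p f] s by simp
    next
      case False
      then have S0: "0 < S" using S by simp
      have "S powr (1 / s) * S powr (1 / t) = S"
        using S0 ts by (simp add: add.commute flip: powr_add)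
      then have "S powr (1 / s) * S powr (1 / t) \<le> alg_norm G p f * S powr (1 / t)"
        using key nx by simp
      then show ?thesis using S0 norm_f by simp
    qed
  qed
qed

lemma RD_alg_norm_2_le:
  assumes q: "1 \<le> q" and l: "length_function G l"
    and RD: "\<And>f. f \<in> group_algebra G \<Longrightarrow> {\<gamma>. f \<gamma> \<noteq> 0} \<subseteq> length_ball G l n \<Longrightarrow>
      alg_norm G q f \<le> c * ell_norm q (carrier G) f"
    and f: "f \<in> group_algebra G" "{\<gamma>. f \<gamma> \<noteq> 0} \<subseteq> length_ball G l n"
  shows "alg_norm G 2 f \<le> \<bar>c\<bar> * ell_norm q (carrier G) f"
proof (rule alg_norm_2_le[OF q f(1)])
  have nn: "0 \<le> ell_norm q (carrier G) f"
    by (intro ell_norm_nonneg q carrier_not_empty group_algebra_imp_ell f)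
  show "0 \<le> \<bar>c\<bar> * ell_norm q (carrier G) f" using nn by simp
  have abs: "c * ell_norm q (carrier G) f \<le> \<bar>c\<bar> * ell_norm q (carrier G) f"
    by (intro mult_right_mono nn) simp
  show "alg_norm G q f \<le> \<bar>c\<bar> * ell_norm q (carrier G) f"
    by (rule order_trans[OF RD[OF f] abs])
  have "{\<gamma>. star G f \<gamma> \<noteq> 0} \<subseteq> length_ball G l n"
    using f(2) l unfolding star_support[OF f(1)] by (auto simp: length_ball_def length_function_def)
  from RD[OF group_algebra_star[OF f(1)] this] abs
  show "alg_norm G q (star G f) \<le> \<bar>c\<bar> * ell_norm q (carrier G) f"
    unfolding ell_norm_star[OF q f(1)] by (rule order_trans)
qed

end

section \<open>Newton iteration towards idempotents\<close>

lemma abs_poly_le_power: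
  fixes P :: "real poly"
  assumes "1 \<le> x"
  shows "\<bar>poly P x\<bar> \<le> (\<Sum>i\<le>degree P. \<bar>coeff P i\<bar>) * x ^ degree P"
proof -
  have "\<bar>poly P x\<bar> \<le> (\<Sum>i\<le>degree P. \<bar>coeff P i * x ^ i\<bar>)"
    unfolding poly_altdef by (rule sum_abs)
  also have "\<dots> \<le> (\<Sum>i\<le>degree P. \<bar>coeff P i\<bar> * x ^ degree P)"
    using assms by (intro sum_mono) (auto simp: abs_mult intro!: mult_left_mono power_increasing)
  finally show ?thesis by (simp add: sum_distrib_right)
qed

text \<open>The recursion makes \<open>x\<close> decay doubly exponentially, hence faster than any geometric sequence. Halving at each step is recorded because it gives explicit constants; summability
  against \<open>K\<^sup>n\<close> is obtained by the ratio test, since \<open>x (n + 1) \<le> (7 x n) x n\<close> and \<open>7 x n\<close> tends to \<open>0\<close>.\<close>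

lemma newton_decay:
  fixes x :: "nat \<Rightarrow> real"
  assumes nonneg: "\<And>n. 0 \<le> x n" and x0: "x 0 \<le> 1 / 14"
    and step: "\<And>n. x (Suc n) \<le> 4 * x n ^ 3 + 3 * x n ^ 2"
  shows "x n \<le> x 0 / 2 ^ n" and "0 < K \<Longrightarrow> summable (\<lambda>n. K ^ n * x n)"
proof -
  have quad: "x (Suc n) \<le> 7 * x n * x n" if "x n \<le> 1 / 14" for n
  proof -
    have "x n ^ 3 \<le> x n ^ 2" using that nonneg[of n] by (intro power_decreasing) auto
    then show ?thesis using step[of n] by (simp add: power2_eq_square)
  qed
  have half: "x (Suc n) \<le> x n / 2" if "x n \<le> 1 / 14" for n
  proof -
    have "7 * x n * x n \<le> 7 * (1 / 14) * x n"
      using that nonneg[of n] by (intro mult_right_mono) auto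
    then show ?thesis using quad[OF that] by simp
  qed
  have small: "x n \<le> 1 / 14" for n
  proof (induction n)
    case (Suc n)
    then show ?case using half[OF Suc] nonneg[of n] by linarith
  qed (rule x0)
  have geom: "x n \<le> x 0 / 2 ^ n" for n
  proof (induction n)
    case (Suc n)
    then show ?case using half[OF small[of n]] by simp
  qed simp
  then show "x n \<le> x 0 / 2 ^ n" .
  assume K: "0 < K"
  have lim: "(\<lambda>n. x 0 / 2 ^ n) \<longlonglongrightarrow> 0"
    by (rule LIMSEQ_divide_realpow_zero) simp
  have "x \<longlonglongrightarrow> 0"
    by (rule tendsto_sandwich[OF _ _ tendsto_const lim]) (intro always_eventually allI nonneg geom)+
  then have "eventually (\<lambda>n. x n < 1 / (14 * K)) sequentially"
    using K by (intro order_tendstoD(2)) auto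
  then obtain N where N: "\<And>n. n \<ge> N \<Longrightarrow> x n < 1 / (14 * K)"
    unfolding eventually_sequentially by blast
  show "summable (\<lambda>n. K ^ n * x n)"
  proof (rule summable_ratio_test[of "1/2" N])
    fix n assume n: "n \<ge> N"
    have "K * x (Suc n) \<le> K * (7 * x n * x n)" using quad[OF small[of n]] K by simp
    also have "\<dots> = (7 * (K * x n)) * x n" by simp
    also have "\<dots> \<le> (1 / 2) * x n"
      using N[OF n] K nonneg[of n] by (intro mult_right_mono) (auto simp: field_simps)
    finally have "K ^ n * (K * x (Suc n)) \<le> K ^ n * (1 / 2 * x n)"
      using K by (intro mult_left_mono) auto
    then show "norm (K ^ Suc n * x (Suc n)) \<le> 1 / 2 * norm (K ^ n * x n)"
      using K nonneg by (simp add: abs_mult mult_ac)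
  qed simp
qed

text \<open>The Newton step \<open>3e\<^sup>2 - 2e\<^sup>3\<close> for the equation \<open>e\<^sup>2 = e\<close>. It is written, like \<open>defect\<close>, as a linear
  combination \<open>a * f x + b * g x\<close>, so that the lemmas on linear combinations apply without rewriting.\<close>

definition newton :: "('a, 'm) monoid_scheme \<Rightarrow> ('a \<Rightarrow> complex) \<Rightarrow> 'a \<Rightarrow> complex" where
  "newton G e = (\<lambda>x. 3 * conv G e e x + (-2) * conv G e (conv G e e) x)"

definition defect :: "('a, 'm) monoid_scheme \<Rightarrow> ('a \<Rightarrow> complex) \<Rightarrow> 'a \<Rightarrow> complex" where
  "defect G e = (\<lambda>x. 1 * conv G e e x + (-1) * e x)"

context group
begin

lemma group_algebra_newton: "e \<in> group_algebra G \<Longrightarrow> newton G e \<in> group_algebra G"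
  unfolding newton_def by (intro group_algebra_lincomb group_algebra_conv)

lemma group_algebra_defect: "e \<in> group_algebra G \<Longrightarrow> defect G e \<in> group_algebra G"
  unfolding defect_def by (intro group_algebra_lincomb group_algebra_conv)

text \<open>Expressing convolution with \<open>e\<^sup>2 - e\<close>, and with the Newton step, through iterates of the single
  operator \<open>conv G e\<close> reduces the identities between polynomials in \<open>e\<close> to linear algebra.\<close>

lemma conv_defect:
  assumes e: "e \<in> group_algebra G"
  shows "conv G (defect G e) \<xi> = (\<lambda>x. 1 * conv G e (conv G e \<xi>) x + (-1) * conv G e \<xi> x)"
  unfolding defect_def conv_lincomb_left[OF group_algebra_conv[OF e e] e] conv_assoc[OF e e] ..

lemma newton_minus:
  assumes e: "e \<in> group_algebra G"
  shows "newton G e x - e x = 1 * defect G e x + (-2) * conv G e (defect G e) x"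
  unfolding newton_def defect_def conv_lincomb_right by (simp add: algebra_simps)

lemma defect_newton:
  assumes e: "e \<in> group_algebra G"
  defines "h \<equiv> defect G e"
  shows "defect G (newton G e) = (\<lambda>x. 4 * conv G h (conv G h h) x + (-3) * conv G h h x)"
proof -
  have newton: "conv G (newton G e) \<xi> =
      (\<lambda>x. 3 * conv G e (conv G e \<xi>) x + (-2) * conv G e (conv G e (conv G e \<xi>)) x)" for \<xi>
    unfolding newton_def
    by (simp only: conv_lincomb_left[OF group_algebra_conv[OF e e] group_algebra_conv[OF e group_algebra_conv[OF e e]]]
        conv_assoc[OF e e] conv_assoc[OF e group_algebra_conv[OF e e]])
  show ?thesis
    unfolding defect_def[of G "newton G e"] newton h_def conv_defect[OF e]
    unfolding newton_def defect_def conv_lincomb_right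
    by (simp add: fun_eq_iff algebra_simps)
qed

lemma alg_norm_newton_minus:
  assumes r: "1 \<le> r" and e: "e \<in> group_algebra G"
  shows "alg_norm G r (\<lambda>x. newton G e x - e x) \<le> (1 + 2 * alg_norm G r e) * alg_norm G r (defect G e)"
proof -
  note h = group_algebra_defect[OF e]
  have "alg_norm G r (\<lambda>x. newton G e x - e x)
      \<le> cmod 1 * alg_norm G r (defect G e) + cmod (-2) * alg_norm G r (conv G e (defect G e))"
    unfolding newton_minus[OF e] by (rule alg_norm_lincomb[OF r h group_algebra_conv[OF e h]])
  also have "\<dots> \<le> alg_norm G r (defect G e) + 2 * (alg_norm G r e * alg_norm G r (defect G e))"
    using alg_norm_conv[OF r e h] by simp
  finally show ?thesis by (simp add: algebra_simps)
qed

lemma alg_norm_defect_newton: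
  assumes r: "1 \<le> r" and e: "e \<in> group_algebra G"
  shows "alg_norm G r (defect G (newton G e))
    \<le> 4 * alg_norm G r (defect G e) ^ 3 + 3 * alg_norm G r (defect G e) ^ 2"
proof -
  define h where "h = defect G e"
  have h: "h \<in> group_algebra G" unfolding h_def by (rule group_algebra_defect[OF e])
  note hh = group_algebra_conv[OF h h]
  have 2: "alg_norm G r (conv G h h) \<le> alg_norm G r h ^ 2"
    using alg_norm_conv[OF r h h] by (simp add: power2_eq_square)
  have "alg_norm G r (conv G h (conv G h h)) \<le> alg_norm G r h * alg_norm G r (conv G h h)"
    by (rule alg_norm_conv[OF r h hh])
  also have "\<dots> \<le> alg_norm G r h * alg_norm G r h ^ 2"
    by (intro mult_left_mono 2 alg_norm_nonneg r h)
  finally have 3: "alg_norm G r (conv G h (conv G h h)) \<le> alg_norm G r h ^ 3"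
    by (simp add: power3_eq_cube power2_eq_square)
  have "alg_norm G r (defect G (newton G e))
      \<le> cmod 4 * alg_norm G r (conv G h (conv G h h)) + cmod (-3) * alg_norm G r (conv G h h)"
    unfolding defect_newton[OF e] h_def[symmetric]
    by (rule alg_norm_lincomb[OF r group_algebra_conv[OF h hh] hh])
  then show ?thesis using 2 3 by (simp add: h_def)
qed

lemma conv_length_ball:
  assumes l: "length_function G l" and f: "f \<in> group_algebra G"
    and "{x. f x \<noteq> 0} \<subseteq> length_ball G l m" "{x. g x \<noteq> 0} \<subseteq> length_ball G l n"
  shows "{x. conv G f g x \<noteq> 0} \<subseteq> length_ball G l (m + n)"
proof
  fix x assume "x \<in> {x. conv G f g x \<noteq> 0}"
  then have "conv G f g x \<noteq> 0" by simp
  from conv_support[OF f this] obtain \<gamma> \<beta>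
    where gb: "\<gamma> \<in> carrier G" "\<beta> \<in> carrier G" "f \<gamma> \<noteq> 0" "g \<beta> \<noteq> 0" "x = \<gamma> \<otimes> \<beta>" by blast
  have "l \<gamma> \<le> real m" "l \<beta> \<le> real n" using gb assms by (auto simp: length_ball_def)
  moreover have "l (\<gamma> \<otimes> \<beta>) \<le> l \<gamma> + l \<beta>" using l gb by (simp add: length_function_def)
  ultimately show "x \<in> length_ball G l (m + n)" using gb by (simp add: length_ball_def)
qed

lemma length_ball_mono: "m \<le> n \<Longrightarrow> length_ball G l m \<subseteq> length_ball G l n"
  by (auto simp: length_ball_def intro: order_trans[of _ "real m"])

lemma lincomb_length_ball:
  assumes "{x. f x \<noteq> 0} \<subseteq> length_ball G l m" "{x. g x \<noteq> 0} \<subseteq> length_ball G l n" "m \<le> k" "n \<le> k"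
  shows "{x. a * f x + b * g x \<noteq> (0 :: complex)} \<subseteq> length_ball G l k"
  using assms length_ball_mono[of m k l] length_ball_mono[of n k l] by force

text \<open>One step is a polynomial of degree \<open>3\<close> in \<open>e\<close>, so the radius of the support at most triples.\<close>

lemma newton_length_ball:
  assumes l: "length_function G l" and e: "e \<in> group_algebra G"
    and "{x. e x \<noteq> 0} \<subseteq> length_ball G l k"
  shows "{x. newton G e x \<noteq> 0} \<subseteq> length_ball G l (3 * k)"
    and "{x. defect G e x \<noteq> 0} \<subseteq> length_ball G l (3 * k)"
proof -
  have 2: "{x. conv G e e x \<noteq> 0} \<subseteq> length_ball G l (k + k)"
    by (rule conv_length_ball[OF l e assms(3,3)])
  have 3: "{x. conv G e (conv G e e) x \<noteq> 0} \<subseteq> length_ball G l (k + (k + k))"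
    by (rule conv_length_ball[OF l e assms(3) 2])
  show "{x. newton G e x \<noteq> 0} \<subseteq> length_ball G l (3 * k)"
    unfolding newton_def by (rule lincomb_length_ball[OF 2 3]) simp_all
  show "{x. defect G e x \<noteq> 0} \<subseteq> length_ball G l (3 * k)"
    unfolding defect_def by (rule lincomb_length_ball[OF 2 assms(3)]) simp_all
qed

text \<open>The increments are controlled by the defects, whose sum is at most twice the first one. The second
  smallness hypothesis is chosen so that the iterates never leave the ball of radius \<open>1/4\<close> around
  \<open>f\<close>; this in turn keeps their norms below \<open>N\<^sub>r(f) + 1\<close>, which is where the factor \<open>3 + 2 N\<^sub>r(f)\<close> comes from.\<close>

lemma newton_iteration:
  assumes r: "1 \<le> r" and f: "f \<in> group_algebra G"
    and small: "alg_norm G r (defect G f) \<le> 1 / 14"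
      "(3 + 2 * alg_norm G r f) * (2 * alg_norm G r (defect G f)) \<le> 1 / 4"
  defines "e \<equiv> (\<lambda>n. (newton G ^^ n) f)"
  shows "e n \<in> group_algebra G"
    and "alg_norm G r (\<lambda>x. f x - e n x) \<le> 1 / 4"
    and "alg_norm G r (\<lambda>x. e (Suc n) x - e n x) \<le> (3 + 2 * alg_norm G r f) * alg_norm G r (defect G (e n))"
    and "0 < K \<Longrightarrow> summable (\<lambda>n. K ^ n * alg_norm G r (defect G (e n)))"
proof -
  have e0: "e 0 = f" and eS: "e (Suc n) = newton G (e n)" for n by (simp_all add: e_def)
  have e: "e n \<in> group_algebra G" for n
    by (induction n) (simp_all add: e0 eS f group_algebra_newton)
  then show "e n \<in> group_algebra G" .
  define x where "x n = alg_norm G r (defect G (e n))" for n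
  have x0: "0 \<le> x n" for n unfolding x_def by (intro alg_norm_nonneg r group_algebra_defect e)
  note decay = newton_decay[of x, OF x0 small(1)[folded e0, folded x_def]
      alg_norm_defect_newton[OF r e, folded eS, folded x_def]]
  show "summable (\<lambda>n. K ^ n * alg_norm G r (defect G (e n)))" if "0 < K"
    using decay(2)[OF that] unfolding x_def .
  define c where "c = 3 + 2 * alg_norm G r f"
  have c: "0 \<le> c" using alg_norm_nonneg[OF r f] by (simp add: c_def)
  have bound_e: "alg_norm G r (e n) \<le> alg_norm G r f + 1"
    if "alg_norm G r (\<lambda>x. e n x - f x) \<le> 1 / 4" for n
  proof -
    have "alg_norm G r (e n) = alg_norm G r (\<lambda>x. 1 * (e n x - f x) + 1 * f x)" by simp
    also have "\<dots> \<le> cmod 1 * alg_norm G r (\<lambda>x. e n x - f x) + cmod 1 * alg_norm G r f"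
      by (rule alg_norm_lincomb[OF r group_algebra_diff[OF e f] f])
    finally show ?thesis using that by simp
  qed
  have step: "alg_norm G r (\<lambda>x. e (Suc n) x - e n x) \<le> c * x n"
    if "alg_norm G r (\<lambda>x. e n x - f x) \<le> 1 / 4" for n
  proof -
    have "alg_norm G r (\<lambda>x. e (Suc n) x - e n x) \<le> (1 + 2 * alg_norm G r (e n)) * x n"
      unfolding eS x_def by (rule alg_norm_newton_minus[OF r e])
    also have "\<dots> \<le> c * x n"
      using bound_e[OF that] by (intro mult_right_mono x0) (simp add: c_def)
    finally show ?thesis .
  qed
  have cx: "c * (2 * x 0) \<le> 1 / 4" using small(2) by (simp add: c_def x_def e0)
  have dist: "alg_norm G r (\<lambda>x. e n x - f x) \<le> c * (2 * x 0) * (1 - 1 / 2 ^ n)" for n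
  proof (induction n)
    case 0
    have "alg_norm G r (\<lambda>x. 0 * f x + 0 * f x) \<le> 0"
      using alg_norm_lincomb[OF r f f, of 0 0] by simp
    then show ?case by (simp add: e0)
  next
    case (Suc n)
    have "c * (2 * x 0) * (1 - 1 / 2 ^ n) \<le> c * (2 * x 0) * 1"
      using c x0[of 0] by (intro mult_left_mono) auto
    then have quarter: "alg_norm G r (\<lambda>x. e n x - f x) \<le> 1 / 4" using Suc cx by linarith
    have "alg_norm G r (\<lambda>x. e (Suc n) x - f x)
        = alg_norm G r (\<lambda>x. 1 * (e (Suc n) x - e n x) + 1 * (e n x - f x))" by simp
    also have "\<dots> \<le> cmod 1 * alg_norm G r (\<lambda>x. e (Suc n) x - e n x) + cmod 1 * alg_norm G r (\<lambda>x. e n x - f x)"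
      by (intro alg_norm_lincomb r group_algebra_diff e f)
    also have "\<dots> \<le> c * (x 0 / 2 ^ n) + c * (2 * x 0) * (1 - 1 / 2 ^ n)"
      using order_trans[OF step[OF quarter] mult_left_mono[OF decay(1)[of n] c]] Suc by simp
    also have "\<dots> = c * (2 * x 0) * (1 - 1 / 2 ^ Suc n)" by (simp add: field_simps)
    finally show ?case .
  qed
  have quarter: "alg_norm G r (\<lambda>x. e n x - f x) \<le> 1 / 4" for n
  proof -
    have "c * (2 * x 0) * (1 - 1 / 2 ^ n) \<le> c * (2 * x 0) * 1"
      using c x0[of 0] by (intro mult_left_mono) auto
    then show ?thesis using dist[of n] cx by linarith
  qed
  have "alg_norm G r (\<lambda>x. f x - e n x) = alg_norm G r (\<lambda>x. (-1) * (e n x - f x) + 0 * f x)" by simp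
  also have "\<dots> \<le> cmod (-1) * alg_norm G r (\<lambda>x. e n x - f x) + cmod 0 * alg_norm G r f"
    by (intro alg_norm_lincomb r group_algebra_diff e f)
  finally show "alg_norm G r (\<lambda>x. f x - e n x) \<le> 1 / 4" using quarter[of n] by simp
  show "alg_norm G r (\<lambda>x. e (Suc n) x - e n x) \<le> (3 + 2 * alg_norm G r f) * alg_norm G r (defect G (e n))"
    using step[OF quarter] by (simp add: c_def x_def)
qed

section \<open>Limits of almost idempotent elements\<close>

text \<open>Completeness of the reduced algebra, for sequences with summable increments and vanishing defects.
  The limit operator is the pointwise limit of the convolutions \<open>f n\<close>; the tails \<open>\<epsilon> n\<close> of the series of increments bound its
  distance from \<open>f n\<close>, by Fatou's lemma. Since \<open>T \<delta>\<close>, with \<open>\<delta>\<close> the unit mass, is the pointwise limit of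
  the \<open>f n\<close>, the operator determines the limit of their coefficients.\<close>

lemma reduced_algebra_limit_idempotent:
  assumes r: "1 \<le> r" and f: "\<And>n. f n \<in> group_algebra G"
    and sm: "summable (\<lambda>n. alg_norm G r (\<lambda>x. f (Suc n) x - f n x))"
    and defect: "(\<lambda>n. alg_norm G r (defect G (f n))) \<longlonglongrightarrow> 0"
  obtains T where "idempotent (reduced_algebra G r) T"
    and "\<And>x. (\<lambda>n. f n x) \<longlonglongrightarrow> T (unit_delta G) x"
proof -
  note I = carrier_not_empty
  let ?E = "ell r (carrier G)" and ?N = "ell_norm r (carrier G)"
  define d where "d n = alg_norm G r (\<lambda>x. f (Suc n) x - f n x)" for n
  have d0: "0 \<le> d n" for n unfolding d_def by (intro alg_norm_nonneg r group_algebra_diff f)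
  have sd: "summable d" using sm by (simp add: d_def[abs_def])
  define \<epsilon> where "\<epsilon> n = suminf d - sum d {..<n}" for n
  have eps0: "0 \<le> \<epsilon> n" for n
    unfolding \<epsilon>_def using sum_le_suminf[OF sd, of "{..<n}"] d0 by simp
  have eps_lim: "\<epsilon> \<longlonglongrightarrow> 0"
    unfolding \<epsilon>_def using tendsto_diff[OF tendsto_const summable_LIMSEQ[OF sd], of "suminf d"] by simp
  have cauchy: "alg_norm G r (\<lambda>x. f m x - f n x) \<le> \<epsilon> n" if "n \<le> m" for m n
  proof -
    have "alg_norm G r (\<lambda>x. f m x - f n x) \<le> sum d {..<m} - sum d {..<n}"
      using that
    proof (induction m rule: dec_induct)
      case base
      have "alg_norm G r (\<lambda>x. 0 * f n x + 0 * f n x) \<le> 0"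
        using alg_norm_lincomb[OF r f f, of 0 n 0 n] by simp
      then show ?case by simp
    next
      case (step m)
      have "alg_norm G r (\<lambda>x. f (Suc m) x - f n x)
          = alg_norm G r (\<lambda>x. 1 * (f (Suc m) x - f m x) + 1 * (f m x - f n x))" by simp
      also have "\<dots> \<le> cmod 1 * d m + cmod 1 * alg_norm G r (\<lambda>x. f m x - f n x)"
        unfolding d_def by (intro alg_norm_lincomb r group_algebra_diff f)
      finally show ?case using step by simp
    qed
    also have "\<dots> \<le> \<epsilon> n"
      unfolding \<epsilon>_def using sum_le_suminf[OF sd, of "{..<m}"] d0 by simp
    finally show ?thesis .
  qed
  have fN: "alg_norm G r (f n) \<le> \<epsilon> 0 + alg_norm G r (f 0)" for n
  proof -
    have "alg_norm G r (f n) = alg_norm G r (\<lambda>x. 1 * (f n x - f 0 x) + 1 * f 0 x)" by simp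
    also have "\<dots> \<le> cmod 1 * alg_norm G r (\<lambda>x. f n x - f 0 x) + cmod 1 * alg_norm G r (f 0)"
      by (intro alg_norm_lincomb r group_algebra_diff f)
    finally show ?thesis using cauchy[of 0 n] by simp
  qed
  have diff: "?N (\<lambda>\<alpha>. conv G (f m) \<xi> \<alpha> - conv G (f n) \<xi> \<alpha>) \<le> \<epsilon> n * ?N \<xi>"
    if "n \<le> m" "\<xi> \<in> ?E" for m n \<xi>
  proof -
    have "?N (conv G (\<lambda>x. f m x - f n x) \<xi>) \<le> alg_norm G r (\<lambda>x. f m x - f n x) * ?N \<xi>"
      by (intro ell_norm_conv_le r group_algebra_diff f that)
    also have "\<dots> \<le> \<epsilon> n * ?N \<xi>"
      by (intro mult_right_mono cauchy that ell_norm_nonneg r I)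
    finally show ?thesis by (simp add: conv_diff_left[OF f f])
  qed
  define T where "T = (\<lambda>\<xi>\<in>?E. \<lambda>\<alpha>. lim (\<lambda>n. conv G (f n) \<xi> \<alpha>))"
  have tends: "(\<lambda>n. conv G (f n) \<xi> \<alpha>) \<longlonglongrightarrow> T \<xi> \<alpha>" if xi: "\<xi> \<in> ?E" for \<xi> \<alpha>
  proof -
    have "Cauchy (\<lambda>n. conv G (f n) \<xi> \<alpha>)"
    proof (rule CauchyI')
      fix e :: real assume "0 < e"
      have "(\<lambda>n. \<epsilon> n * ?N \<xi>) \<longlonglongrightarrow> 0" by (rule tendsto_mult_left_zero[OF eps_lim])
      then have "eventually (\<lambda>n. \<epsilon> n * ?N \<xi> < e) sequentially"
        using \<open>0 < e\<close> by (rule order_tendstoD(2))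
      then obtain M where M: "\<And>n. n \<ge> M \<Longrightarrow> \<epsilon> n * ?N \<xi> < e"
        unfolding eventually_sequentially by blast
      have "dist (conv G (f m) \<xi> \<alpha>) (conv G (f n) \<xi> \<alpha>) < e" if "m \<ge> M" "n > m" for m n
      proof -
        have "cmod (conv G (f n) \<xi> \<alpha> - conv G (f m) \<xi> \<alpha>)
            \<le> ?N (\<lambda>\<alpha>. conv G (f n) \<xi> \<alpha> - conv G (f m) \<xi> \<alpha>)"
          by (rule cmod_le_ell_norm[OF r I ell_diff(1)[OF r I ell_conv(1)[OF r f xi] ell_conv(1)[OF r f xi]]])
        also have "\<dots> \<le> \<epsilon> m * ?N \<xi>" using that xi by (intro diff) auto
        also have "\<dots> < e" by (rule M[OF that(1)])
        finally show ?thesis by (simp add: dist_norm norm_minus_commute)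
      qed
      then show "\<exists>M. \<forall>m\<ge>M. \<forall>n>m. dist (conv G (f m) \<xi> \<alpha>) (conv G (f n) \<xi> \<alpha>) < e" by blast
    qed
    then have "convergent (\<lambda>n. conv G (f n) \<xi> \<alpha>)" by (rule Cauchy_convergent)
    then show ?thesis using xi by (simp add: T_def convergent_LIMSEQ_iff)
  qed
  have T_out: "T \<xi> \<alpha> = 0" if "\<xi> \<in> ?E" "\<alpha> \<notin> carrier G" for \<xi> \<alpha>
    using LIMSEQ_unique[OF tends[OF that(1), of \<alpha>]] conv_outside[OF that(2)] by simp
  have close: "(\<lambda>\<alpha>. T \<xi> \<alpha> - conv G (f n) \<xi> \<alpha>) \<in> ?E"
    "?N (\<lambda>\<alpha>. T \<xi> \<alpha> - conv G (f n) \<xi> \<alpha>) \<le> \<epsilon> n * ?N \<xi>" if xi: "\<xi> \<in> ?E" for \<xi> n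
  proof -
    have out: "T \<xi> \<alpha> - conv G (f n) \<xi> \<alpha> = 0" if "\<alpha> \<notin> carrier G" for \<alpha>
      by (simp add: T_out[OF xi that] conv_outside[OF that])
    have mem: "(\<lambda>\<alpha>. conv G (f (m + n)) \<xi> \<alpha> - conv G (f n) \<xi> \<alpha>) \<in> ?E" for m
      by (intro ell_diff(1) r I ell_conv(1) f xi)
    have le: "?N (\<lambda>\<alpha>. conv G (f (m + n)) \<xi> \<alpha> - conv G (f n) \<xi> \<alpha>) \<le> \<epsilon> n * ?N \<xi>" for m
      by (intro diff xi) simp
    have lim: "(\<lambda>m. conv G (f (m + n)) \<xi> \<alpha> - conv G (f n) \<xi> \<alpha>) \<longlonglongrightarrow> T \<xi> \<alpha> - conv G (f n) \<xi> \<alpha>" for \<alpha>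
      by (intro tendsto_diff tendsto_const LIMSEQ_ignore_initial_segment tends xi)
    show "(\<lambda>\<alpha>. T \<xi> \<alpha> - conv G (f n) \<xi> \<alpha>) \<in> ?E"
      by (rule ell_norm_limit_le(1)[OF r I out mem le tendsto_const lim])
    show "?N (\<lambda>\<alpha>. T \<xi> \<alpha> - conv G (f n) \<xi> \<alpha>) \<le> \<epsilon> n * ?N \<xi>"
      by (rule ell_norm_limit_le(2)[OF r I out mem le tendsto_const lim])
  qed
  have TE: "T \<xi> \<in> ?E" and TN: "?N (T \<xi>) \<le> (\<epsilon> 0 + alg_norm G r (f 0)) * ?N \<xi>" if xi: "\<xi> \<in> ?E" for \<xi>
  proof -
    have eq: "T \<xi> = (\<lambda>\<alpha>. (T \<xi> \<alpha> - conv G (f 0) \<xi> \<alpha>) + conv G (f 0) \<xi> \<alpha>)" by simp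
    show "T \<xi> \<in> ?E"
      by (subst eq, rule ell_add(1)[OF r I close(1)[OF xi] ell_conv(1)[OF r f xi]])
    have "?N (T \<xi>) \<le> ?N (\<lambda>\<alpha>. T \<xi> \<alpha> - conv G (f 0) \<xi> \<alpha>) + ?N (conv G (f 0) \<xi>)"
      by (subst eq, rule ell_add(2)[OF r I close(1)[OF xi] ell_conv(1)[OF r f xi]])
    also have "\<dots> \<le> \<epsilon> 0 * ?N \<xi> + alg_norm G r (f 0) * ?N \<xi>"
      by (intro add_mono close(2) ell_norm_conv_le r f xi)
    finally show "?N (T \<xi>) \<le> (\<epsilon> 0 + alg_norm G r (f 0)) * ?N \<xi>" by (simp add: distrib_right)
  qed
  have T_lin: "T (\<lambda>x. a * \<xi> x + b * \<eta> x) = (\<lambda>x. a * T \<xi> x + b * T \<eta> x)"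
    if xi: "\<xi> \<in> ?E" and eta: "\<eta> \<in> ?E" for a b \<xi> \<eta>
  proof
    fix \<alpha>
    have "(\<lambda>x. a * \<xi> x + b * \<eta> x) \<in> ?E" by (intro ell_add(1) ell_scale(1) r I that)
    from tends[OF this, of \<alpha>]
    show "T (\<lambda>x. a * \<xi> x + b * \<eta> x) \<alpha> = a * T \<xi> \<alpha> + b * T \<eta> \<alpha>"
      unfolding conv_lincomb_right
      by (rule LIMSEQ_unique) (intro tendsto_add tendsto_mult tendsto_const tends that)
  qed
  have T_op: "T \<in> ell_operators r (carrier G)"
    unfolding ell_operators_def mem_Collect_eq
  proof (intro conjI ballI allI exI)
    show "T \<in> ?E \<rightarrow>\<^sub>E ?E" using TE by (auto simp: T_def)
    show "T (\<lambda>x. \<xi> x + \<eta> x) = (\<lambda>x. T \<xi> x + T \<eta> x)" if "\<xi> \<in> ?E" "\<eta> \<in> ?E" for \<xi> \<eta>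
      using T_lin[OF that, of 1 1] by simp
    show "T (\<lambda>x. c * \<xi> x) = (\<lambda>x. c * T \<xi> x)" if "\<xi> \<in> ?E" for \<xi> c
      using T_lin[OF that that, of c 0] by simp
    show "?N (T \<xi>) \<le> (\<epsilon> 0 + alg_norm G r (f 0)) * ?N \<xi>" if "\<xi> \<in> ?E" for \<xi>
      by (rule TN[OF that])
  qed
  have approx: "\<exists>g\<in>group_algebra G. op_norm r (carrier G)
      (\<lambda>\<xi>\<in>?E. \<lambda>\<alpha>. T \<xi> \<alpha> - left_regular_alg G r g \<xi> \<alpha>) < e" if e: "e > 0" for e
  proof -
    obtain n where n: "\<epsilon> n < e"
      using order_tendstoD(2)[OF eps_lim e] unfolding eventually_sequentially by blast
    have "op_norm r (carrier G) (\<lambda>\<xi>\<in>?E. \<lambda>\<alpha>. T \<xi> \<alpha> - left_regular_alg G r (f n) \<xi> \<alpha>) \<le> \<epsilon> n"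
      by (rule op_norm_le[OF r I eps0]) (simp add: left_regular_alg_eq_conv[OF f] close(2))
    then show ?thesis using n f by (intro bexI[of _ "f n"]) auto
  qed
  have TT: "T (T \<xi>) = T \<xi>" if xi: "\<xi> \<in> ?E" for \<xi>
  proof
    fix \<alpha>
    \<comment> \<open>The difference \<open>f\<^sub>n T\<xi> - f\<^sub>n \<xi>\<close> tends to \<open>T T\<xi> - T\<xi>\<close>, and it is the sum of \<open>f\<^sub>n (T\<xi> - f\<^sub>n \<xi>)\<close> and
      \<open>(f\<^sub>n\<^sup>2 - f\<^sub>n) \<xi>\<close>, which are both small.\<close>
    let ?z = "\<lambda>n. conv G (f n) (T \<xi>) \<alpha> - conv G (f n) \<xi> \<alpha>"
    have le: "cmod (?z n) \<le> ((\<epsilon> 0 + alg_norm G r (f 0)) * \<epsilon> n + alg_norm G r (defect G (f n))) * ?N \<xi>" for n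
    proof -
      define u where "u = conv G (f n) (\<lambda>\<alpha>. T \<xi> \<alpha> - conv G (f n) \<xi> \<alpha>)"
      define v where "v = conv G (defect G (f n)) \<xi>"
      have u: "u \<in> ?E" unfolding u_def by (intro ell_conv(1) r f close(1) xi)
      have v: "v \<in> ?E" unfolding v_def by (intro ell_conv(1) r f group_algebra_defect xi)
      have "?z n = u \<alpha> + v \<alpha>"
        by (simp add: u_def v_def conv_defect[OF f] conv_diff_right)
      then have "cmod (?z n) \<le> cmod (u \<alpha>) + cmod (v \<alpha>)" by (simp add: norm_triangle_ineq)
      also have "\<dots> \<le> ?N u + ?N v" by (intro add_mono cmod_le_ell_norm r I u v)
      also have "?N u \<le> alg_norm G r (f n) * ?N (\<lambda>\<alpha>. T \<xi> \<alpha> - conv G (f n) \<xi> \<alpha>)"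
        unfolding u_def by (intro ell_norm_conv_le r f close(1) xi)
      also have "\<dots> \<le> (\<epsilon> 0 + alg_norm G r (f 0)) * (\<epsilon> n * ?N \<xi>)"
        using eps0[of 0] alg_norm_nonneg[OF r f, of 0]
        by (intro mult_mono fN close xi ell_norm_nonneg r I) simp
      also have "?N v \<le> alg_norm G r (defect G (f n)) * ?N \<xi>"
        unfolding v_def by (intro ell_norm_conv_le r f group_algebra_defect xi)
      finally show ?thesis by (simp add: algebra_simps)
    qed
    have "(\<lambda>n. ((\<epsilon> 0 + alg_norm G r (f 0)) * \<epsilon> n + alg_norm G r (defect G (f n))) * ?N \<xi>) \<longlonglongrightarrow> 0"
      using tendsto_mult_right[OF tendsto_add[OF tendsto_mult_left[OF eps_lim] defect],
          of "\<epsilon> 0 + alg_norm G r (f 0)" "?N \<xi>"] by simp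
    then have "?z \<longlonglongrightarrow> 0"
      by (rule Lim_null_comparison[rotated]) (simp add: le)
    moreover have "?z \<longlonglongrightarrow> T (T \<xi>) \<alpha> - T \<xi> \<alpha>"
      by (intro tendsto_diff tends TE xi)
    ultimately show "T (T \<xi>) \<alpha> = T \<xi> \<alpha>" using LIMSEQ_unique by fastforce
  qed
  have "idempotent (reduced_algebra G r) T"
    unfolding idempotent_def reduced_algebra_def Let_def
  proof (simp add: T_op approx, rule ext)
    fix \<xi> show "compose ?E T T \<xi> = T \<xi>"
    proof (cases "\<xi> \<in> ?E")
      case True
      then show ?thesis by (simp add: compose_def TT)
    next
      case False
      then show ?thesis by (simp add: compose_def T_def)
    qed
  qed
  moreover have "(\<lambda>n. f n x) \<longlonglongrightarrow> T (unit_delta G) x" for x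
    using tends[OF group_algebra_imp_ell[OF r unit_delta_in_group_algebra], of x]
    by (simp add: conv_unit_right[OF f])
  ultimately show ?thesis by (rule that)
qed

section \<open>Idempotents close to the group algebra\<close>

text \<open>If \<open>f\<close> is within \<open>\<epsilon>\<close> of \<open>a\<close>, then \<open>f\<^sup>2 - f = f(f - a) + (f - a)a + (a - f)\<close> has norm at most
  \<open>\<epsilon>(2A + 1 + \<epsilon>)\<close>, where \<open>A\<close> bounds \<open>a\<close>. The bounds in the conclusion are the hypotheses of
  \<open>newton_iteration\<close>.\<close>

lemma almost_idempotent_approximation:
  assumes r: "1 \<le> r" and a_op: "a \<in> ell_operators r (carrier G)"
    and aa: "\<And>\<xi>. \<xi> \<in> ell r (carrier G) \<Longrightarrow> a (a \<xi>) = a \<xi>"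
    and approx: "\<And>e. e > 0 \<Longrightarrow> \<exists>f\<in>group_algebra G. op_norm r (carrier G)
      (\<lambda>\<xi>\<in>ell r (carrier G). \<lambda>\<alpha>. a \<xi> \<alpha> - left_regular_alg G r f \<xi> \<alpha>) < e"
  obtains f where "f \<in> group_algebra G" and "alg_norm G r (defect G f) \<le> 1 / 14"
    and "(3 + 2 * alg_norm G r f) * (2 * alg_norm G r (defect G f)) \<le> 1 / 4"
    and "\<And>\<xi>. \<xi> \<in> ell r (carrier G) \<Longrightarrow>
      ell_norm r (carrier G) (\<lambda>\<alpha>. a \<xi> \<alpha> - conv G f \<xi> \<alpha>) \<le> 1 / 4 * ell_norm r (carrier G) \<xi>"
proof -
  note I = carrier_not_empty
  let ?E = "ell r (carrier G)" and ?N = "ell_norm r (carrier G)"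
  have aE: "a \<xi> \<in> ?E" if "\<xi> \<in> ?E" for \<xi> using a_op that by (auto simp: ell_operators_def)
  have a_scale: "a (\<lambda>x. c * \<xi> x) = (\<lambda>x. c * a \<xi> x)" if "\<xi> \<in> ?E" for c \<xi>
    using a_op that by (auto simp: ell_operators_def)
  obtain K where K: "\<And>\<xi>. \<xi> \<in> ?E \<Longrightarrow> ?N (a \<xi>) \<le> K * ?N \<xi>"
    using a_op unfolding ell_operators_def by blast
  define A where "A = \<bar>K\<bar>"
  have A0: "0 \<le> A" by (simp add: A_def)
  have aN: "?N (a \<xi>) \<le> A * ?N \<xi>" if "\<xi> \<in> ?E" for \<xi>
    by (rule order_trans[OF K[OF that]]) (auto simp: A_def intro!: mult_right_mono ell_norm_nonneg r I that)

  \<comment> \<open>With this choice \<open>8 \<epsilon> (A + 3)\<^sup>2 = 1/4\<close>, which is the second smallness condition of the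
    conclusion, as \<open>N\<^sub>r(f)\<close> is at most \<open>A + \<epsilon>\<close> and the defect at most \<open>2 \<epsilon> (A + 3)\<close>.\<close>
  define \<epsilon> where "\<epsilon> = 1 / (32 * (A + 3)\<^sup>2)"
  have eps: "0 < \<epsilon>" using A0 by (simp add: \<epsilon>_def)
  have R2: "\<epsilon> * (A + 3)\<^sup>2 = 1 / 32" using A0 by (simp add: \<epsilon>_def)
  have R1: "\<epsilon> * (A + 3) \<le> 1 / 96"
  proof -
    have "3 * (A + 3) \<le> (A + 3)\<^sup>2" 
      unfolding power2_eq_square using A0 by (intro mult_right_mono) simp_all
    then have "\<epsilon> * (3 * (A + 3)) \<le> \<epsilon> * (A + 3)\<^sup>2" using eps by (intro mult_left_mono) auto
    then show ?thesis unfolding R2 by (simp add: algebra_simps)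
  qed
  have R0: "\<epsilon> \<le> 1 / 288"
  proof -
    have "\<epsilon> * 3 \<le> \<epsilon> * (A + 3)" using A0 eps by (intro mult_left_mono) auto
    then show ?thesis using R1 by simp
  qed
  obtain f where f: "f \<in> group_algebra G" and f_close: "op_norm r (carrier G)
      (\<lambda>\<xi>\<in>?E. \<lambda>\<alpha>. a \<xi> \<alpha> - left_regular_alg G r f \<xi> \<alpha>) < \<epsilon>"
    using approx[OF eps] by blast
  have close: "?N (\<lambda>\<alpha>. a \<xi> \<alpha> - conv G f \<xi> \<alpha>) \<le> \<epsilon> * ?N \<xi>" if xi: "\<xi> \<in> ?E" for \<xi>
  proof -
    let ?D = "\<lambda>\<xi>\<in>?E. \<lambda>\<alpha>. a \<xi> \<alpha> - left_regular_alg G r f \<xi> \<alpha>"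
    have D: "?D \<xi> = (\<lambda>\<alpha>. a \<xi> \<alpha> - conv G f \<xi> \<alpha>)" if "\<xi> \<in> ?E" for \<xi>
      using that by (simp add: left_regular_alg_eq_conv[OF f])
    have "?N (?D \<xi>) \<le> op_norm r (carrier G) ?D * ?N \<xi>"
    proof (rule ell_norm_le_op_norm[OF r I _ _ _ xi])
      fix \<eta> assume e: "\<eta> \<in> ?E"
      show "?D \<eta> \<in> ?E" unfolding D[OF e] by (intro ell_diff(1) r I aE ell_conv(1) f e)
      show "?D (\<lambda>x. c * \<eta> x) = (\<lambda>x. c * ?D \<eta> x)" for c
        unfolding D[OF e] D[OF ell_scale(1)[OF r I e]]
        using conv_lincomb_right[of G f c \<eta> 0 \<eta>] a_scale[OF e, of c] by (simp add: algebra_simps)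
      have "?N (?D \<eta>) \<le> ?N (a \<eta>) + ?N (conv G f \<eta>)"
        unfolding D[OF e] by (intro ell_diff(2) r I aE ell_conv(1) f e)
      also have "\<dots> \<le> A * ?N \<eta> + alg_norm G r f * ?N \<eta>"
        by (intro add_mono aN ell_norm_conv_le r f e)
      finally show "?N (?D \<eta>) \<le> (A + alg_norm G r f) * ?N \<eta>" by (simp add: distrib_right)
    qed
    also have "\<dots> \<le> \<epsilon> * ?N \<xi>"
      using f_close by (intro mult_right_mono ell_norm_nonneg r I xi) simp
    finally show ?thesis by (simp only: D[OF xi])
  qed
  have mem: "(\<lambda>\<alpha>. a \<xi> \<alpha> - conv G f \<xi> \<alpha>) \<in> ?E" if "\<xi> \<in> ?E" for \<xi>
    by (intro ell_diff(1) r I aE ell_conv(1) f that)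
  have fN: "alg_norm G r f \<le> A + \<epsilon>"
  proof (rule alg_norm_le[OF r f])
    show "0 \<le> A + \<epsilon>" using A0 eps by simp
    fix \<xi> assume xi: "\<xi> \<in> ?E"
    have "?N (\<lambda>\<alpha>. a \<xi> \<alpha> - (a \<xi> \<alpha> - conv G f \<xi> \<alpha>)) \<le> A * ?N \<xi> + \<epsilon> * ?N \<xi>"
      by (rule order_trans[OF ell_diff(2)[OF r I aE[OF xi] mem[OF xi]]]) (intro add_mono aN close xi)
    then show "?N (conv G f \<xi>) \<le> (A + \<epsilon>) * ?N \<xi>" by (simp add: distrib_right)
  qed
  have defect: "alg_norm G r (defect G f) \<le> \<epsilon> * (2 * (A + 3))"
  proof (rule alg_norm_le[OF r group_algebra_defect[OF f]])
    show "0 \<le> \<epsilon> * (2 * (A + 3))" using A0 eps by simp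
    fix \<xi> assume xi: "\<xi> \<in> ?E"
    define u where "u = (\<lambda>\<alpha>. a \<xi> \<alpha> - conv G f \<xi> \<alpha>)"
    define v where "v = (\<lambda>\<alpha>. a (a \<xi>) \<alpha> - conv G f (a \<xi>) \<alpha>)"
    have u: "u \<in> ?E" "?N u \<le> \<epsilon> * ?N \<xi>" unfolding u_def by (rule mem[OF xi], rule close[OF xi])
    have v: "v \<in> ?E" unfolding v_def by (rule mem[OF aE[OF xi]])
    have "?N v \<le> \<epsilon> * ?N (a \<xi>)" unfolding v_def by (rule close[OF aE[OF xi]])
    also have "\<dots> \<le> \<epsilon> * (A * ?N \<xi>)" using eps by (intro mult_left_mono aN xi) simp
    finally have vN: "?N v \<le> \<epsilon> * A * ?N \<xi>" by simp
    have fu: "conv G f u \<in> ?E" by (intro ell_conv(1) r f u)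
    have "?N (conv G f u) \<le> alg_norm G r f * ?N u" by (intro ell_norm_conv_le r f u)
    also have "\<dots> \<le> (A + \<epsilon>) * (\<epsilon> * ?N \<xi>)"
      using A0 eps by (intro mult_mono fN u ell_norm_nonneg r I) simp_all
    finally have fuN: "?N (conv G f u) \<le> (A + \<epsilon>) * (\<epsilon> * ?N \<xi>)" .
    have "conv G (defect G f) \<xi> = (\<lambda>\<alpha>. (u \<alpha> - v \<alpha>) - conv G f u \<alpha>)"
      by (simp add: u_def v_def conv_defect[OF f] conv_diff_right aa[OF xi])
    then have "?N (conv G (defect G f) \<xi>) \<le> ?N u + ?N v + ?N (conv G f u)"
      using ell_diff(2)[OF r I ell_diff(1)[OF r I u(1) v] fu] ell_diff(2)[OF r I u(1) v] by simp
    also have "\<dots> \<le> \<epsilon> * ?N \<xi> + \<epsilon> * A * ?N \<xi> + (A + \<epsilon>) * (\<epsilon> * ?N \<xi>)"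
      by (intro add_mono u vN fuN)
    also have "\<dots> = \<epsilon> * (2 * A + 1 + \<epsilon>) * ?N \<xi>" by (simp add: algebra_simps)
    also have "\<dots> \<le> \<epsilon> * (2 * (A + 3)) * ?N \<xi>"
      using eps R0 A0 by (intro mult_right_mono mult_left_mono ell_norm_nonneg r I xi) simp_all
    finally show "?N (conv G (defect G f) \<xi>) \<le> \<epsilon> * (2 * (A + 3)) * ?N \<xi>" .
  qed
  have small1: "alg_norm G r (defect G f) \<le> 1 / 14" using defect R1 by (simp add: algebra_simps)
  have small2: "(3 + 2 * alg_norm G r f) * (2 * alg_norm G r (defect G f)) \<le> 1 / 4"
  proof -
    have "(3 + 2 * alg_norm G r f) * (2 * alg_norm G r (defect G f))
        \<le> (2 * (A + 3)) * (2 * (\<epsilon> * (2 * (A + 3))))"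
      using fN R0 defect A0 eps alg_norm_nonneg[OF r group_algebra_defect[OF f]]
      by (intro mult_mono) simp_all
    also have "\<dots> = 8 * (\<epsilon> * (A + 3)\<^sup>2)" by (simp add: power2_eq_square algebra_simps)
    finally show ?thesis by (simp add: R2)
  qed
  have "?N (\<lambda>\<alpha>. a \<xi> \<alpha> - conv G f \<xi> \<alpha>) \<le> 1 / 4 * ?N \<xi>" if xi: "\<xi> \<in> ?E" for \<xi>
  proof -
    have "\<epsilon> * ?N \<xi> \<le> 1 / 4 * ?N \<xi>"
      using R0 by (intro mult_right_mono ell_norm_nonneg r I xi) simp
    then show ?thesis using close[OF xi] by linarith
  qed
  then show ?thesis by (rule that[OF f small1 small2])
qed

text \<open>The heart of the argument: an almost idempotent element of the group algebra is close to \<open>0\<close> or \<open>1\<close>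
  in \<open>N\<^sub>r\<close>, because Newton's method started from it converges in \<open>C\<^sup>*\<^sub>r(\<Gamma>)\<close> to an idempotent. The
  doubly exponential decay measured in \<open>N\<^sub>r\<close> absorbs the polynomial growth of the constants that
  dominate \<open>N\<^sub>2\<close> by \<open>N\<^sub>r\<close> on the growing supports.\<close>

lemma almost_idempotent_near_scalar:
  fixes P :: "real poly"
  assumes r: "1 \<le> r" and l: "length_function G l"
    and dom: "\<And>n f. f \<in> group_algebra G \<Longrightarrow> {\<gamma>. f \<gamma> \<noteq> 0} \<subseteq> length_ball G l n \<Longrightarrow>
      alg_norm G 2 f \<le> \<bar>poly P (real n)\<bar> * alg_norm G r f"
    and triv: "\<not> (\<exists>T. nontrivial_idempotent (reduced_algebra G 2) T)"
    and f: "f \<in> group_algebra G" and small1: "alg_norm G r (defect G f) \<le> 1 / 14"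
    and small2: "(3 + 2 * alg_norm G r f) * (2 * alg_norm G r (defect G f)) \<le> 1 / 4"
  obtains b :: complex where "b = 0 \<or> b = 1"
    and "alg_norm G r (\<lambda>x. f x - b * unit_delta G x) \<le> 1 / 4"
proof -
  define e where "e n = (newton G ^^ n) f" for n
  note newton = newton_iteration[OF r f small1 small2, folded e_def]
  have eS: "e (Suc n) = newton G (e n)" for n by (simp add: e_def)
  \<comment> \<open>Radii of balls are natural numbers; a radius of at least \<open>1\<close> allows the polynomial to be
    estimated by its leading power.\<close>
  obtain m :: nat where m: "1 \<le> m" "{x. f x \<noteq> 0} \<subseteq> length_ball G l m"
  proof -
    define m where "m = nat (ceiling (Max (insert 1 (l ` {x. f x \<noteq> 0}))))"
    have fin: "finite {x. f x \<noteq> 0}" "{x. f x \<noteq> 0} \<subseteq> carrier G"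
      using f by (auto simp: group_algebra_def)
    have le: "t \<le> real m" if "t \<in> insert 1 (l ` {x. f x \<noteq> 0})" for t
    proof -
      have "t \<le> Max (insert 1 (l ` {x. f x \<noteq> 0}))" using fin that by (intro Max_ge) auto
      also have "\<dots> \<le> real m" unfolding m_def by (rule real_nat_ceiling_ge)
      finally show ?thesis .
    qed
    show ?thesis
      by (rule that[of m]) (use le[of 1] le fin in \<open>auto simp: length_ball_def\<close>)
  qed
  have e_ball: "{x. e n x \<noteq> 0} \<subseteq> length_ball G l (3 ^ n * m)" for n
  proof (induction n)
    case 0
    then show ?case using m by (simp add: e_def)
  next
    case (Suc n)
    then show ?case
      using newton_length_ball(1)[OF l newton(1) Suc] by (simp add: eS mult.assoc)
  qed
  define D where "D = (\<Sum>i\<le>degree P. \<bar>coeff P i\<bar>) * (3 * real m) ^ degree P"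
  have weight: "\<bar>poly P (real (3 * (3 ^ n * m)))\<bar> \<le> D * (3 ^ degree P) ^ n" for n
  proof -
    have "1 \<le> (3 :: nat) * (3 ^ n * m)" using m(1) by simp
    then have "1 \<le> real (3 * (3 ^ n * m))" by linarith
    from abs_poly_le_power[OF this, of P] show ?thesis
      by (simp add: D_def power_mult_distrib mult_ac flip: power_mult)
  qed
  define x where "x n = alg_norm G r (defect G (e n))" for n
  have x0: "0 \<le> x n" for n unfolding x_def by (intro alg_norm_nonneg r group_algebra_defect newton(1))
  have xs: "summable (\<lambda>n. (3 ^ degree P) ^ n * x n)"
    unfolding x_def by (rule newton(4)) simp
  define c where "c = 3 + 2 * alg_norm G r f"
  have c0: "1 \<le> c" using alg_norm_nonneg[OF r f] by (simp add: c_def)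
  \<comment> \<open>A common bound in \<open>N\<^sub>2\<close> for the \<open>n\<close>-th increment and the \<open>n\<close>-th defect. Both are supported in
    the ball of radius \<open>3\<^sup>n\<^sup>+\<^sup>1 m\<close>, where the loss is at most \<open>D\<close> times the \<open>n\<close>-th power of \<open>3\<^sup>d\<close>,
    with \<open>d\<close> the degree of \<open>P\<close>.\<close>
  define y where "y n = D * c * ((3 ^ degree P) ^ n * x n)" for n
  have ys: "summable y" unfolding y_def by (rule summable_mult[OF xs])
  have D0: "0 \<le> D" by (simp add: D_def sum_nonneg)
  have bound: "alg_norm G 2 g \<le> y n"
    if g: "g \<in> group_algebra G" "{x. g x \<noteq> 0} \<subseteq> length_ball G l (3 * (3 ^ n * m))" "alg_norm G r g \<le> c * x n"
    for g n
  proof -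
    have "alg_norm G 2 g \<le> \<bar>poly P (real (3 * (3 ^ n * m)))\<bar> * alg_norm G r g"
      by (rule dom[OF g(1,2)])
    also have "\<dots> \<le> (D * (3 ^ degree P) ^ n) * (c * x n)"
      using D0 by (intro mult_mono weight g alg_norm_nonneg r) simp
    finally show ?thesis by (simp add: y_def mult_ac)
  qed
  have step2: "alg_norm G 2 (\<lambda>x. e (Suc n) x - e n x) \<le> y n" for n
  proof (rule bound)
    show "(\<lambda>x. e (Suc n) x - e n x) \<in> group_algebra G" by (intro group_algebra_diff newton(1))
    have "{x. 1 * e (Suc n) x + (-1) * e n x \<noteq> 0} \<subseteq> length_ball G l (3 * (3 ^ n * m))"
      by (rule lincomb_length_ball[OF e_ball e_ball]) (simp_all add: mult.assoc)
    then show "{x. e (Suc n) x - e n x \<noteq> 0} \<subseteq> length_ball G l (3 * (3 ^ n * m))" by simp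
    show "alg_norm G r (\<lambda>x. e (Suc n) x - e n x) \<le> c * x n"
      unfolding c_def x_def by (rule newton(3))
  qed
  have defect2: "alg_norm G 2 (defect G (e n)) \<le> y n" for n
  proof (rule bound)
    show "defect G (e n) \<in> group_algebra G" by (intro group_algebra_defect newton(1))
    show "{x. defect G (e n) x \<noteq> 0} \<subseteq> length_ball G l (3 * (3 ^ n * m))"
      by (rule newton_length_ball(2)[OF l newton(1) e_ball])
    show "alg_norm G r (defect G (e n)) \<le> c * x n"
      using mult_right_mono[OF c0 x0[of n]] by (simp add: x_def)
  qed
  have two: "1 \<le> (2 :: ennreal)" by simp
  have sum2: "summable (\<lambda>n. alg_norm G 2 (\<lambda>x. e (Suc n) x - e n x))"
  proof (rule summable_comparison_test'[OF ys])
    fix n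
    have "0 \<le> alg_norm G 2 (\<lambda>x. e (Suc n) x - e n x)"
      by (intro alg_norm_nonneg two group_algebra_diff newton(1))
    then show "norm (alg_norm G 2 (\<lambda>x. e (Suc n) x - e n x)) \<le> y n" using step2[of n] by simp
  qed
  have lim2: "(\<lambda>n. alg_norm G 2 (defect G (e n))) \<longlonglongrightarrow> 0"
  proof (rule tendsto_sandwich[OF _ _ tendsto_const summable_LIMSEQ_zero[OF ys]])
    show "\<forall>\<^sub>F n in sequentially. 0 \<le> alg_norm G 2 (defect G (e n))"
      by (intro always_eventually allI alg_norm_nonneg two group_algebra_defect newton(1))
    show "\<forall>\<^sub>F n in sequentially. alg_norm G 2 (defect G (e n)) \<le> y n"
      by (intro always_eventually allI defect2)
  qed
  obtain T where T: "idempotent (reduced_algebra G 2) T"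
    and T_lim: "\<And>x. (\<lambda>n. e n x) \<longlonglongrightarrow> T (unit_delta G) x"
    using reduced_algebra_limit_idempotent[OF two newton(1) sum2 lim2] by blast
  have delta2: "unit_delta G \<in> ell 2 (carrier G)"
    by (intro group_algebra_imp_ell two unit_delta_in_group_algebra)
  have "T = (\<lambda>\<xi>\<in>ell 2 (carrier G). \<lambda>\<alpha>. 0) \<or> T = (\<lambda>\<xi>\<in>ell 2 (carrier G). \<xi>)"
    using triv T by (auto simp: nontrivial_idempotent_def reduced_algebra_def Let_def)
  then have T_cases: "T (unit_delta G) = (\<lambda>x. 0 * unit_delta G x) \<or> T (unit_delta G) = (\<lambda>x. 1 * unit_delta G x)"
    using delta2 by auto
  obtain b :: complex where b: "b = 0 \<or> b = 1" "\<And>x. (\<lambda>n. e n x) \<longlonglongrightarrow> b * unit_delta G x"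
    using T_cases T_lim by metis

  have near: "alg_norm G r (\<lambda>x. f x - b * unit_delta G x) \<le> 1 / 4"
  proof (rule alg_norm_limit_le[OF r _ _ newton(2)])
    show "(\<lambda>x. f x - b * unit_delta G x) \<in> group_algebra G"
      using group_algebra_lincomb[OF f unit_delta_in_group_algebra, of 1 "-b"] by simp
    show "(\<lambda>x. f x - e n x) \<in> group_algebra G" for n by (intro group_algebra_diff f newton(1))
    show "(\<lambda>n. f x - e n x) \<longlonglongrightarrow> f x - b * unit_delta G x" for x
      by (intro tendsto_diff tendsto_const b(2))
  qed
  from b(1) near show ?thesis by (rule that)
qed

text \<open>If \<open>b = 0\<close>, vectors in the range of \<open>a\<close> are fixed by \<open>a\<close> and shrunk by the factor \<open>1/2\<close>, so they vanish;
  if \<open>b = 1\<close>, the same holds for \<open>1 - a\<close>.\<close>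

lemma idempotent_near_scalar:
  assumes r: "1 \<le> r" and a_op: "a \<in> ell_operators r (carrier G)"
    and aa: "\<And>\<xi>. \<xi> \<in> ell r (carrier G) \<Longrightarrow> a (a \<xi>) = a \<xi>"
    and b: "b = 0 \<or> b = 1"
    and near: "\<And>\<xi>. \<xi> \<in> ell r (carrier G) \<Longrightarrow>
      ell_norm r (carrier G) (\<lambda>\<alpha>. a \<xi> \<alpha> - b * \<xi> \<alpha>) \<le> 1 / 2 * ell_norm r (carrier G) \<xi>"
  shows "a = (\<lambda>\<xi>\<in>ell r (carrier G). \<lambda>\<alpha>. 0) \<or> a = (\<lambda>\<xi>\<in>ell r (carrier G). \<xi>)"
proof -
  note I = carrier_not_empty
  let ?E = "ell r (carrier G)" and ?N = "ell_norm r (carrier G)"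
  have aE: "a \<xi> \<in> ?E" if "\<xi> \<in> ?E" for \<xi> using a_op that by (auto simp: ell_operators_def)
  have a_ext: "a \<in> extensional ?E" using a_op by (auto simp: ell_operators_def PiE_def)
  have a_add: "a (\<lambda>x. \<xi> x + \<eta> x) = (\<lambda>x. a \<xi> x + a \<eta> x)" if "\<xi> \<in> ?E" "\<eta> \<in> ?E" for \<xi> \<eta>
    using a_op that by (auto simp: ell_operators_def)
  have a_scale: "a (\<lambda>x. c * \<xi> x) = (\<lambda>x. c * a \<xi> x)" if "\<xi> \<in> ?E" for c \<xi>
    using a_op that by (auto simp: ell_operators_def)
  have contract: "\<zeta> = (\<lambda>x. 0)" if "\<zeta> \<in> ?E" "?N \<zeta> \<le> 1 / 2 * ?N \<zeta>" for \<zeta>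
    using that by (intro ell_norm_eq_0[OF r I]) auto
  show ?thesis
    using b
  proof
    assume b: "b = 0"
    have "a \<xi> = (\<lambda>x. 0)" if xi: "\<xi> \<in> ?E" for \<xi>
      using near[OF aE[OF xi]] aa[OF xi] b by (intro contract aE xi) simp
    then have "a = (\<lambda>\<xi>\<in>?E. \<lambda>\<alpha>. 0)"
      using a_ext by (intro extensionalityI[of _ ?E]) auto
    then show ?thesis by blast
  next
    assume b: "b = 1"
    have "a \<xi> = \<xi>" if xi: "\<xi> \<in> ?E" for \<xi>
    proof -
      define \<zeta> where "\<zeta> = (\<lambda>x. a \<xi> x + (-1) * \<xi> x)"
      have z: "\<zeta> \<in> ?E" unfolding \<zeta>_def by (intro ell_add(1) ell_scale(1) r I aE xi)
      have "a \<zeta> = (\<lambda>x. 0)"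
        unfolding \<zeta>_def using a_add[OF aE[OF xi] ell_scale(1)[OF r I xi, of "-1"]] a_scale[OF xi, of "-1"] aa[OF xi]
        by simp
      then have "?N (\<lambda>x. 0 - \<zeta> x) \<le> 1 / 2 * ?N \<zeta>" using near[OF z] b by simp
      then have "\<zeta> = (\<lambda>x. 0)" using ell_norm_diff_commute[of r "carrier G" "\<lambda>x. 0" \<zeta>] by (intro contract z) simp
      then show ?thesis by (simp add: \<zeta>_def fun_eq_iff)
    qed
    then have "a = (\<lambda>\<xi>\<in>?E. \<xi>)"
      using a_ext by (intro extensionalityI[of _ ?E]) auto
    then show ?thesis by blast
  qed
qed

text \<open>The exponent \<open>r\<close> enters only through the domination of \<open>N\<^sub>2\<close> by \<open>N\<^sub>r\<close> on balls. That is what makes one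
  argument serve both \<open>p\<close> and \<open>q\<close>.\<close>

lemma idempotent_trivial_if_RD:
  fixes P :: "real poly"
  assumes r: "1 \<le> r" and l: "length_function G l"
    and dom: "\<And>n f. f \<in> group_algebra G \<Longrightarrow> {\<gamma>. f \<gamma> \<noteq> 0} \<subseteq> length_ball G l n \<Longrightarrow>
      alg_norm G 2 f \<le> \<bar>poly P (real n)\<bar> * alg_norm G r f"
    and triv: "\<not> (\<exists>T. nontrivial_idempotent (reduced_algebra G 2) T)"
  shows "\<not> nontrivial_idempotent (reduced_algebra G r) a"
proof
  assume a: "nontrivial_idempotent (reduced_algebra G r) a"
  note I = carrier_not_empty
  let ?E = "ell r (carrier G)" and ?N = "ell_norm r (carrier G)"
  have a_op: "a \<in> ell_operators r (carrier G)"
    and a_approx: "\<And>e. e > 0 \<Longrightarrow> \<exists>f\<in>group_algebra G. op_norm r (carrier G)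
      (\<lambda>\<xi>\<in>?E. \<lambda>\<alpha>. a \<xi> \<alpha> - left_regular_alg G r f \<xi> \<alpha>) < e"
    and a_idem: "compose ?E a a = a"
    and a_nontriv: "a \<noteq> (\<lambda>\<xi>\<in>?E. \<lambda>\<alpha>. 0)" "a \<noteq> (\<lambda>\<xi>\<in>?E. \<xi>)"
    using a by (auto simp: nontrivial_idempotent_def idempotent_def reduced_algebra_def Let_def)
  have aE: "a \<xi> \<in> ?E" if "\<xi> \<in> ?E" for \<xi> using a_op that by (auto simp: ell_operators_def)
  have aa: "a (a \<xi>) = a \<xi>" if "\<xi> \<in> ?E" for \<xi>
    using fun_cong[OF a_idem, of \<xi>] that by (simp add: compose_def)
  obtain f where f: "f \<in> group_algebra G"
    and small: "alg_norm G r (defect G f) \<le> 1 / 14"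
      "(3 + 2 * alg_norm G r f) * (2 * alg_norm G r (defect G f)) \<le> 1 / 4"
    and close: "\<And>\<xi>. \<xi> \<in> ?E \<Longrightarrow> ?N (\<lambda>\<alpha>. a \<xi> \<alpha> - conv G f \<xi> \<alpha>) \<le> 1 / 4 * ?N \<xi>"
    using almost_idempotent_approximation[OF r a_op aa a_approx] by blast
  obtain b :: complex where b: "b = 0 \<or> b = 1"
    and near: "alg_norm G r (\<lambda>x. f x - b * unit_delta G x) \<le> 1 / 4"
    using almost_idempotent_near_scalar[OF r l dom triv f small] by blast
  have near_a: "?N (\<lambda>\<alpha>. a \<xi> \<alpha> - b * \<xi> \<alpha>) \<le> 1 / 2 * ?N \<xi>" if xi: "\<xi> \<in> ?E" for \<xi>
  proof -
    define g where "g = (\<lambda>x. f x - b * unit_delta G x)"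
    have g: "g \<in> group_algebra G"
      unfolding g_def using group_algebra_lincomb[OF f unit_delta_in_group_algebra, of 1 "-b"] by simp
    have "conv G g \<xi> = (\<lambda>\<alpha>. conv G f \<xi> \<alpha> - b * \<xi> \<alpha>)"
      unfolding g_def
      using conv_lincomb_left[OF f unit_delta_in_group_algebra, of 1 "-b" \<xi>]
        conv_unit_left[OF ell_zero_outside[OF xi]] by simp
    then have eq: "(\<lambda>\<alpha>. a \<xi> \<alpha> - b * \<xi> \<alpha>) = (\<lambda>\<alpha>. (a \<xi> \<alpha> - conv G f \<xi> \<alpha>) + conv G g \<xi> \<alpha>)" by simp
    have "?N (\<lambda>\<alpha>. a \<xi> \<alpha> - b * \<xi> \<alpha>) \<le> 1 / 4 * ?N \<xi> + alg_norm G r g * ?N \<xi>"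
      unfolding eq
      by (rule order_trans[OF ell_add(2)[OF r I ell_diff(1)[OF r I aE[OF xi] ell_conv(1)[OF r f xi]]
            ell_conv(1)[OF r g xi]]])
        (intro add_mono close ell_norm_conv_le r g xi)
    also have "\<dots> = (1 / 4 + alg_norm G r g) * ?N \<xi>" by (simp add: distrib_right)
    also have "\<dots> \<le> 1 / 2 * ?N \<xi>"
      using near by (intro mult_right_mono ell_norm_nonneg r I xi) (simp add: g_def)
    finally show ?thesis .
  qed
  show False using idempotent_near_scalar[OF r a_op aa b near_a] a_nontriv by blast
qed

end

text \<open>By the two comparisons \<open>\<parallel>f\<parallel>\<^sub>q \<le> N\<^sub>p(f)\<close> and \<open>\<parallel>f\<parallel>\<^sub>q \<le> N\<^sub>q(f)\<close>, property \<open>(RD)\<^sub>q\<close> dominates \<open>N\<^sub>2\<close> on balls both by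
  \<open>N\<^sub>p\<close> and by \<open>N\<^sub>q\<close>.\<close>

theorem theorem2:
  fixes G :: "('a, 'm) monoid_scheme" and p q :: ennreal
  assumes "group G"
    and "1 \<le> p" and "1 / p + 1 / q = 1"
    and "property_RD G q"
    and "\<not> (\<exists>a. nontrivial_idempotent (reduced_cstar_algebra G) a)"
  shows "\<not> (\<exists>a. nontrivial_idempotent (reduced_algebra G p) a) \<and>
         \<not> (\<exists>a. nontrivial_idempotent (reduced_algebra G q) a)"
proof -
  interpret group G by (rule assms(1))
  have q: "1 \<le> q" by (rule conjugate_exponent_ge_1[OF assms(3)])
  obtain l P where l: "length_function G l"
    and RD: "\<And>n f. f \<in> group_algebra G \<Longrightarrow> {\<gamma>. f \<gamma> \<noteq> 0} \<subseteq> length_ball G l n \<Longrightarrow>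
      alg_norm G q f \<le> poly P (real n) * ell_norm q (carrier G) f"
    using assms(4) unfolding property_RD_def RD_wrt_def by blast
  have triv: "\<not> nontrivial_idempotent (reduced_algebra G r) a"
    if r: "1 \<le> r" and le: "\<And>f. f \<in> group_algebra G \<Longrightarrow> ell_norm q (carrier G) f \<le> alg_norm G r f" for r a
  proof (rule idempotent_trivial_if_RD[OF r l])
    fix n f assume f: "f \<in> group_algebra G" "{\<gamma>. f \<gamma> \<noteq> 0} \<subseteq> length_ball G l n"
    have "alg_norm G 2 f \<le> \<bar>poly P (real n)\<bar> * ell_norm q (carrier G) f"
      by (rule RD_alg_norm_2_le[OF q l RD f])
    also have "\<dots> \<le> \<bar>poly P (real n)\<bar> * alg_norm G r f"
      by (intro mult_left_mono le f) simp
    finally show "alg_norm G 2 f \<le> \<bar>poly P (real n)\<bar> * alg_norm G r f" .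
  qed (use assms(5) in \<open>simp add: reduced_cstar_algebra_def\<close>)
  show ?thesis
    using triv[OF assms(2) ell_norm_le_conjugate_alg_norm[OF assms(2) q assms(3)]]
      triv[OF q ell_norm_le_alg_norm[OF q]] by blast
qed

end
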